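(* Let $(G,g)$ be the initial algebra of $F=M\otimes -$ on the category of tri-pointed sets, with $G$ equipped with its canonical metric (so that $g:M\otimes G\to G$ is an isometric isomorphism). Then $(G,g)$ is not the initial algebra for $F$ on the category $\mathbf{Met}_3^{C}$ of tri-pointed metric spaces and continuous maps preserving the distinguished points, and it is not the initial algebra for $F$ on the category $\mathbf{Met}_3^{L}$ of tri-pointed metric spaces and Lipschitz maps preserving the distinguished points.
   Context: A tri-pointed set is a set $X$ with three distinguished elements $T,L,R$ (written $T_X,L_X,R_X$). A tri-pointed metric space is a tri-pointed set with a metric $d$ satisfying $d(x,y)\le 1$ for all $x,y$ and such that any two different ones of the distinguished elements are at distance exactly $1$. Let $M=\{a,b,c\}$. For a tri-pointed set $X$, $M\otimes X$ is the quotient of $M\times X$ by the equivalence relation generated by $(b,T)\sim(a,L)$, $(a,R)\sim(c,T)$, $(c,L)\sim(b,R)$; the class of $(m,x)$ is written $m\otimes x$. Its distinguished elements are $T_{M\otimes X}=a\otimes T$, $L_{M\otimes X}=b\otimes L$, $R_{M\otimes X}=c\otimes R$. If $X$ is a tri-pointed metric space, $M\times X$ has the metric $d((m,x),(n,y))=\frac12 d(x,y)$ if $m=n$ and $1$ if $m\ne n$, and $M\otimes X$ has the quotient metric, which is explicitly: $d(m\otimes x,m\otimes y)=\frac12 d(x,y)$; $d(a\otimes x,b\otimes y)=\frac12\min\{d(x,L)+d(T,y),\,d(x,R)+1+d(R,y)\}$; $d(a\otimes x,c\otimes y)=\frac12\min\{d(x,R)+d(T,y),\,d(x,L)+1+d(L,y)\}$;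 $d(b\otimes x,c\otimes y)=\frac12\min\{d(x,R)+d(L,y),\,d(x,T)+1+d(T,y)\}$. This is again a tri-pointed metric space. The functor $F=M\otimes -$ acts on morphisms by $(M\otimes f)(m\otimes x)=m\otimes f(x)$; $M^n\otimes -$ is its $n$-fold iterate, with elements $m_1\otimes\cdots\otimes m_n\otimes x$. An $F$-algebra is a pair $(X,e)$ with $e:F(X)\to X$ a morphism of the category; an algebra morphism $(X,e)\to(Y,e')$ is a morphism $f:X\to Y$ with $f\circ e=e'\circ F(f)$; an algebra is initial if it has exactly one algebra morphism to every algebra. Let $I=\{T,L,R\}$ with the discrete metric, and $!:I\to M\otimes I$ the map $T\mapsto a\otimes T$, $L\mapsto b\otimes L$, $R\mapsto c\otimes R$. $G$ is the colimit of $I\xrightarrow{!}M\otimes I\xrightarrow{M\otimes !}M^2\otimes I\to\cdots$, i.e. the quotient of the disjoint union of the $M^n\otimes I$ identifying each element with its images along the chain; $[\chi]$ is the class of $\chi$. Distinguished points of $G$: $[T],[L],[R]$. All chain maps are isometric embeddings, and the canonical metric of $G$ is $d_G([\chi],[\chi'])=d(\tilde\chi,\tilde\chi')$, where $\tilde\chi,\tilde\chi'$ are images of $\chi,\chi'$ in a common $M^p\otimes I$. The structure map is $g(m\otimes[x])=[m\otimes x]$. *)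

theory Defs
  imports "HOL-Analysis.Analysis"
begin

text \<open>Tri-pointed sets and tri-pointed metric spaces, carried by a subset of a type.\<close>

record 'a tri =
  carrier :: "'a set"
  Tpt :: 'a
  Lpt :: 'a
  Rpt :: 'a

record 'a tri_met = "'a tri" +
  dst :: "'a \<Rightarrow> 'a \<Rightarrow> real"

text \<open>The distinguished elements of a tri-pointed set need not be distinct; in a tri-pointed
  metric space they are, being at mutual distance 1.\<close>

definition tripointed :: "('a, 'z) tri_scheme \<Rightarrow> bool" where
  "tripointed X \<longleftrightarrow> Tpt X \<in> carrier X \<and> Lpt X \<in> carrier X \<and> Rpt X \<in> carrier X"

definition tripointed_metric :: "'a tri_met \<Rightarrow> bool" where
  "tripointed_metric X \<longleftrightarrow>
     tripointed X \<and> Metric_space (carrier X) (dst X) \<and>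
     (\<forall>x\<in>carrier X. \<forall>y\<in>carrier X. dst X x y \<le> 1) \<and>
     dst X (Tpt X) (Lpt X) = 1 \<and> dst X (Tpt X) (Rpt X) = 1 \<and> dst X (Lpt X) (Rpt X) = 1"

definition met_of :: "'a tri_met \<Rightarrow> 'a metric" where
  "met_of X = metric (carrier X, dst X)"

text \<open>Hom-sets consist of functions that are \<^const>\<open>undefined\<close> outside the carrier, so that equality
  of morphisms is equality of functions.\<close>

definition set_hom :: "('a, 'y) tri_scheme \<Rightarrow> ('b, 'z) tri_scheme \<Rightarrow> ('a \<Rightarrow> 'b) set" where
  "set_hom X Y = {f \<in> carrier X \<rightarrow>\<^sub>E carrier Y. f (Tpt X) = Tpt Y \<and> f (Lpt X) = Lpt Y \<and> f (Rpt X) = Rpt Y}"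

definition cont_hom :: "'a tri_met \<Rightarrow> 'b tri_met \<Rightarrow> ('a \<Rightarrow> 'b) set" where
  "cont_hom X Y = {f \<in> set_hom X Y. continuous_map (mtopology_of (met_of X)) (mtopology_of (met_of Y)) f}"

definition lip_hom :: "'a tri_met \<Rightarrow> 'b tri_met \<Rightarrow> ('a \<Rightarrow> 'b) set" where
  "lip_hom X Y = {f \<in> set_hom X Y. Lipschitz_continuous_map (met_of X) (met_of Y) f}"

definition isometric_iso :: "'a tri_met \<Rightarrow> 'b tri_met \<Rightarrow> ('a \<Rightarrow> 'b) \<Rightarrow> bool" where
  "isometric_iso X Y f \<longleftrightarrow>
     f \<in> set_hom X Y \<and> bij_betw f (carrier X) (carrier Y) \<and>
     (\<forall>x\<in>carrier X. \<forall>y\<in>carrier X. dst Y (f x) (f y) = dst X x y)"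


subsection \<open>The functor \<open>M \<otimes> -\<close>\<close>

datatype cell = Ca | Cb | Cc

definition generated_equiv :: "'a set \<Rightarrow> 'a rel \<Rightarrow> 'a rel" where
  "generated_equiv A r = (r \<union> r\<inverse>)\<^sup>* \<inter> A \<times> A"

definition tensor_rel :: "('a, 'z) tri_scheme \<Rightarrow> (cell \<times> 'a) rel" where
  "tensor_rel X = generated_equiv (UNIV \<times> carrier X)
     {((Cb, Tpt X), (Ca, Lpt X)), ((Ca, Rpt X), (Cc, Tpt X)), ((Cc, Lpt X), (Cb, Rpt X))}"

definition tensor_elem :: "('a, 'z) tri_scheme \<Rightarrow> cell \<Rightarrow> 'a \<Rightarrow> (cell \<times> 'a) set" where
  "tensor_elem X m x = tensor_rel X `` {(m, x)}"

definition tensor :: "('a, 'z) tri_scheme \<Rightarrow> (cell \<times> 'a) set tri" where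
  "tensor X =
     \<lparr>carrier = (UNIV \<times> carrier X) // tensor_rel X,
      Tpt = tensor_elem X Ca (Tpt X),
      Lpt = tensor_elem X Cb (Lpt X),
      Rpt = tensor_elem X Cc (Rpt X)\<rparr>"

text \<open>\<open>(M \<otimes> f)(m \<otimes> x) = m \<otimes> f x\<close>; for a point-preserving \<open>f\<close> the union is over a constant family.\<close>

definition tensor_map ::
  "('a, 'y) tri_scheme \<Rightarrow> ('b, 'z) tri_scheme \<Rightarrow> ('a \<Rightarrow> 'b) \<Rightarrow> (cell \<times> 'a) set \<Rightarrow> (cell \<times> 'b) set" where
  "tensor_map X Y f = (\<lambda>C\<in>carrier (tensor X). \<Union>(m, x)\<in>C. tensor_elem Y m (f x))"

fun tensor_dst_rep :: "'a tri_met \<Rightarrow> cell \<times> 'a \<Rightarrow> cell \<times> 'a \<Rightarrow> real" where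
  "tensor_dst_rep X (Ca, x) (Ca, y) = dst X x y / 2"
| "tensor_dst_rep X (Cb, x) (Cb, y) = dst X x y / 2"
| "tensor_dst_rep X (Cc, x) (Cc, y) = dst X x y / 2"
| "tensor_dst_rep X (Ca, x) (Cb, y) =
     min (dst X x (Lpt X) + dst X (Tpt X) y) (dst X x (Rpt X) + 1 + dst X (Rpt X) y) / 2"
| "tensor_dst_rep X (Ca, x) (Cc, y) =
     min (dst X x (Rpt X) + dst X (Tpt X) y) (dst X x (Lpt X) + 1 + dst X (Lpt X) y) / 2"
| "tensor_dst_rep X (Cb, x) (Cc, y) =
     min (dst X x (Rpt X) + dst X (Lpt X) y) (dst X x (Tpt X) + 1 + dst X (Tpt X) y) / 2"
| "tensor_dst_rep X (Cb, y) (Ca, x) =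
     min (dst X x (Lpt X) + dst X (Tpt X) y) (dst X x (Rpt X) + 1 + dst X (Rpt X) y) / 2"
| "tensor_dst_rep X (Cc, y) (Ca, x) =
     min (dst X x (Rpt X) + dst X (Tpt X) y) (dst X x (Lpt X) + 1 + dst X (Lpt X) y) / 2"
| "tensor_dst_rep X (Cc, y) (Cb, x) =
     min (dst X x (Rpt X) + dst X (Lpt X) y) (dst X x (Tpt X) + 1 + dst X (Tpt X) y) / 2"

text \<open>The value on representatives does not depend on their choice. Distances involving points
  outside the carrier are set to 0 because \<^const>\<open>Metric_space\<close> asks for symmetry and
  nonnegativity on the whole type.\<close>

definition tensor_dst :: "'a tri_met \<Rightarrow> (cell \<times> 'a) set \<Rightarrow> (cell \<times> 'a) set \<Rightarrow> real" where
  "tensor_dst X C D =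
     (if C \<in> carrier (tensor X) \<and> D \<in> carrier (tensor X)
      then THE r. \<exists>p\<in>C. \<exists>q\<in>D. r = tensor_dst_rep X p q else 0)"

definition tensor_met :: "'a tri_met \<Rightarrow> (cell \<times> 'a) set tri_met" where
  "tensor_met X =
     \<lparr>carrier = carrier (tensor X), Tpt = Tpt (tensor X), Lpt = Lpt (tensor X), Rpt = Rpt (tensor X),
      dst = tensor_dst X\<rparr>"


subsection \<open>Algebras and initiality\<close>

text \<open>A function in the hom-set \<open>H\<close> from \<open>X\<close> to \<open>Y\<close> that commutes with the structure maps.\<close>

definition alg_hom ::
  "('a \<Rightarrow> 'b) set \<Rightarrow> ('a, 'y) tri_scheme \<Rightarrow> ((cell \<times> 'a) set \<Rightarrow> 'a)
    \<Rightarrow> ('b, 'z) tri_scheme \<Rightarrow> ((cell \<times> 'b) set \<Rightarrow> 'b) \<Rightarrow> ('a \<Rightarrow> 'b) set" where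
  "alg_hom H X e Y e' = {f \<in> H. \<forall>p\<in>carrier (tensor X). f (e p) = e' (tensor_map X Y f p)}"

definition set_alg :: "('a, 'z) tri_scheme \<Rightarrow> ((cell \<times> 'a) set \<Rightarrow> 'a) \<Rightarrow> bool" where
  "set_alg X e \<longleftrightarrow> tripointed X \<and> e \<in> set_hom (tensor X) X"

definition cont_alg :: "'a tri_met \<Rightarrow> ((cell \<times> 'a) set \<Rightarrow> 'a) \<Rightarrow> bool" where
  "cont_alg X e \<longleftrightarrow> tripointed_metric X \<and> e \<in> cont_hom (tensor_met X) X"

definition lip_alg :: "'a tri_met \<Rightarrow> ((cell \<times> 'a) set \<Rightarrow> 'a) \<Rightarrow> bool" where
  "lip_alg X e \<longleftrightarrow> tripointed_metric X \<and> e \<in> lip_hom (tensor_met X) X"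

text \<open>HOL cannot quantify over all types inside a formula, so initiality is relative to the type
  \<^typ>\<open>'b\<close> in which the competing algebras are carried.\<close>

definition set_initial :: "('a, 'z) tri_scheme \<Rightarrow> ((cell \<times> 'a) set \<Rightarrow> 'a) \<Rightarrow> 'b itself \<Rightarrow> bool" where
  "set_initial X e (_ :: 'b itself) \<longleftrightarrow> set_alg X e \<and>
     (\<forall>(Y :: 'b tri) e'. set_alg Y e' \<longrightarrow> (\<exists>!f. f \<in> alg_hom (set_hom X Y) X e Y e'))"

definition cont_initial :: "'a tri_met \<Rightarrow> ((cell \<times> 'a) set \<Rightarrow> 'a) \<Rightarrow> 'b itself \<Rightarrow> bool" where
  "cont_initial X e (_ :: 'b itself) \<longleftrightarrow> cont_alg X e \<and>
     (\<forall>(Y :: 'b tri_met) e'. cont_alg Y e' \<longrightarrow> (\<exists>!f. f \<in> alg_hom (cont_hom X Y) X e Y e'))"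

definition lip_initial :: "'a tri_met \<Rightarrow> ((cell \<times> 'a) set \<Rightarrow> 'a) \<Rightarrow> 'b itself \<Rightarrow> bool" where
  "lip_initial X e (_ :: 'b itself) \<longleftrightarrow> lip_alg X e \<and>
     (\<forall>(Y :: 'b tri_met) e'. lip_alg Y e' \<longrightarrow> (\<exists>!f. f \<in> alg_hom (lip_hom X Y) X e Y e'))"


subsection \<open>The iterates \<open>M\<^sup>n \<otimes> I\<close>\<close>

text \<open>
  \<^const>\<open>tensor\<close> changes the carrier type, so it cannot be iterated directly. Instead an element of
  \<open>M\<^sup>n \<otimes> I\<close> is represented by the set of all words \<open>(m\<^sub>1 \<dots> m\<^sub>n, i)\<close> denoting it, and
  each iterate is the previous one with the functor applied, followed by the relabelling
  \<open>flatten\<close>, which is injective on the carriers concerned.\<close>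

datatype corner = CT | CL | CR

type_synonym word_class = "(cell list \<times> corner) set"

definition flatten :: "(cell \<times> word_class) set \<Rightarrow> word_class" where
  "flatten C = {(m # w, i) | m w i. \<exists>D. (m, D) \<in> C \<and> (w, i) \<in> D}"

definition relabel :: "('a \<Rightarrow> 'b) \<Rightarrow> 'a tri_met \<Rightarrow> 'b tri_met" where
  "relabel h X =
     \<lparr>carrier = h ` carrier X, Tpt = h (Tpt X), Lpt = h (Lpt X), Rpt = h (Rpt X),
      dst = (\<lambda>x y. if x \<in> h ` carrier X \<and> y \<in> h ` carrier X
                   then dst X (inv_into (carrier X) h x) (inv_into (carrier X) h y) else 0)\<rparr>"

definition I3 :: "word_class tri_met" where
  "I3 = \<lparr>carrier = {{([], i)} | i. True},
         Tpt = {([], CT)}, Lpt = {([], CL)}, Rpt = {([], CR)},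
         dst = (\<lambda>x y. if x = y then 0 else 1)\<rparr>"

primrec iter :: "nat \<Rightarrow> word_class tri_met" where
  "iter 0 = I3"
| "iter (Suc n) = relabel flatten (tensor_met (iter n))"

text \<open>The element \<open>m \<otimes> \<xi>\<close> of \<open>M\<^sup>n\<^sup>+\<^sup>1 \<otimes> I\<close>, for \<open>\<xi>\<close> in \<open>M\<^sup>n \<otimes> I\<close>.\<close>

definition iter_elem :: "nat \<Rightarrow> cell \<Rightarrow> word_class \<Rightarrow> word_class" where
  "iter_elem n m \<xi> = flatten (tensor_elem (iter n) m \<xi>)"

definition bang :: "word_class \<Rightarrow> word_class" where
  "bang x = (if x = Tpt I3 then iter_elem 0 Ca (Tpt I3)
             else if x = Lpt I3 then iter_elem 0 Cb (Lpt I3)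
             else iter_elem 0 Cc (Rpt I3))"

text \<open>The chain map \<open>M\<^sup>n \<otimes> !\<close> from \<open>M\<^sup>n \<otimes> I\<close> to \<open>M\<^sup>n\<^sup>+\<^sup>1 \<otimes> I\<close>.\<close>

primrec chain :: "nat \<Rightarrow> word_class \<Rightarrow> word_class" where
  "chain 0 = bang"
| "chain (Suc n) = (\<lambda>\<xi>. flatten (tensor_map (iter n) (iter (Suc n)) (chain n)
                                 (inv_into (carrier (tensor (iter n))) flatten \<xi>)))"


subsection \<open>The colimit \<open>G\<close>\<close>

type_synonym gpoint = "(nat \<times> word_class) set"

definition stages :: "(nat \<times> word_class) set" where
  "stages = (SIGMA n:UNIV. carrier (iter n))"

definition colim_rel :: "(nat \<times> word_class) rel" where
  "colim_rel = generated_equiv stages {((n, \<xi>), (Suc n, chain n \<xi>)) | n \<xi>. \<xi> \<in> carrier (iter n)}"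

definition colim_class :: "nat \<Rightarrow> word_class \<Rightarrow> gpoint" where
  "colim_class n \<xi> = colim_rel `` {(n, \<xi>)}"

definition G :: "gpoint tri_met" where
  "G = \<lparr>carrier = stages // colim_rel,
        Tpt = colim_class 0 (Tpt I3), Lpt = colim_class 0 (Lpt I3), Rpt = colim_class 0 (Rpt I3),
        dst = (\<lambda>P Q. if P \<in> stages // colim_rel \<and> Q \<in> stages // colim_rel
                     then THE r. \<exists>p \<xi> \<xi>'. (p, \<xi>) \<in> P \<and> (p, \<xi>') \<in> Q \<and> r = dst (iter p) \<xi> \<xi>'
                     else 0)\<rparr>"

text \<open>\<open>g (m \<otimes> [\<xi>]) = [m \<otimes> \<xi>]\<close>; the union is over a constant family.\<close>

definition g :: "(cell \<times> gpoint) set \<Rightarrow> gpoint" where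
  "g = (\<lambda>C\<in>carrier (tensor G). \<Union>(m, P)\<in>C. \<Union>(n, \<xi>)\<in>P. colim_class (Suc n) (iter_elem n m \<xi>))"

end

theory Submission
  imports Defs
begin

text \<open>
  Replace the metric of \<open>G\<close> by the discrete one. The points of \<open>M \<otimes> G\<close> are then at mutual
  distance at least 1/2, so that every map out of it is Lipschitz and \<open>g\<close> is still a structure
  map. By initiality among tri-pointed sets, the identity is the only candidate for an algebra
  morphism from \<open>G\<close> to the discrete \<open>G\<close>; it is not continuous, because the points
  \<open>a \<otimes> \<dots> \<otimes> a \<otimes> L\<close> converge to \<open>T\<close>.

  That \<open>M \<otimes> X\<close> and \<open>G\<close> are metric spaces rests on one observation: the generated equivalence
  relation is the relation of being at distance 0 for a pseudometric on representatives.\<close>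

section \<open>Quotients by zero distance\<close>

text \<open>One algebra settles both categories: its structure map is Lipschitz, hence also
  continuous, and since no continuous algebra morphism from \<open>G\<close> reaches it, no
  Lipschitz one does. Only uniqueness among tri-pointed sets enters this argument; existence is
  proved for the claim that \<open>G\<close> is initial there. The Lipschitz constant 2 is what
  makes the construction possible. \<open>M \<otimes> -\<close> halves distances inside a cell, and
  a structure map that may double distances can undo the halving at every level: points at distance
  \<open>(1/2)^n\<close> in \<open>G\<close> end up at distance 1 in the discrete copy. For short
  maps the discrete copy would not be an algebra, because \<open>g\<close> sends distinct points at
  distance 1/2 to points at distance 1.\<close>

lemma equiv_generated_equiv: "equiv A (generated_equiv A r)"
proof (rule equivI)
  show "generated_equiv A r \<subseteq> A \<times> A"
    by (simp add: generated_equiv_def)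
  show "refl_on A (generated_equiv A r)"
    by (simp add: generated_equiv_def refl_on_def)
  have "sym ((r \<union> r\<inverse>)\<^sup>*)"
    by (intro sym_rtrancl sym_Un_converse)
  then show "sym (generated_equiv A r)"
    by (auto simp: generated_equiv_def sym_def)
  show "trans (generated_equiv A r)"
    by (auto simp: generated_equiv_def intro!: transI)
qed

lemma generated_equiv_class_eq_iff:
  assumes "x \<in> A" "y \<in> A"
  shows "generated_equiv A r `` {x} = generated_equiv A r `` {y} \<longleftrightarrow> (x, y) \<in> generated_equiv A r"
  using assms eq_equiv_class_iff[OF equiv_generated_equiv] by metis

text \<open>\<open>D_gen\<close> and \<open>D_sep\<close> are the two inclusions between the
  generated relation and the zero set of \<open>D\<close>. \<open>D_sep\<close> only asks for a path
  of generators, since \<open>generated_equiv\<close> restricts the endpoints to \<open>A\<close>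
  afterwards.\<close>

locale pseudometric_quotient =
  fixes A :: "'a set" and r :: "'a rel" and D :: "'a \<Rightarrow> 'a \<Rightarrow> real"
  assumes gen_subset: "r \<subseteq> A \<times> A"
    and D_refl: "x \<in> A \<Longrightarrow> D x x = 0"
    and D_nonneg: "x \<in> A \<Longrightarrow> y \<in> A \<Longrightarrow> 0 \<le> D x y"
    and D_sym: "x \<in> A \<Longrightarrow> y \<in> A \<Longrightarrow> D x y = D y x"
    and D_triangle: "x \<in> A \<Longrightarrow> y \<in> A \<Longrightarrow> z \<in> A \<Longrightarrow> D x z \<le> D x y + D y z"
    and D_gen: "(x, y) \<in> r \<Longrightarrow> D x y = 0"
    and D_sep: "x \<in> A \<Longrightarrow> y \<in> A \<Longrightarrow> D x y = 0 \<Longrightarrow> (x, y) \<in> (r \<union> r\<inverse>)\<^sup>*"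
begin

abbreviation E :: "'a rel" where
  "E \<equiv> generated_equiv A r"

lemma rel_iff: "(x, y) \<in> E \<longleftrightarrow> x \<in> A \<and> y \<in> A \<and> D x y = 0"
proof
  assume xy: "(x, y) \<in> E"
  then have "(x, y) \<in> (r \<union> r\<inverse>)\<^sup>*" and A: "x \<in> A" "y \<in> A"
    by (auto simp: generated_equiv_def)
  from this(1) have "y \<in> A \<and> D x y = 0"
  proof induction
    case base
    then show ?case using A D_refl by simp
  next
    case (step y z)
    then have yz: "y \<in> A" "z \<in> A" and "D y z = 0"
      using gen_subset D_gen D_sym by (auto, metis subsetD mem_Sigma_iff)
    then show ?case
      using step D_triangle[of x y z] D_nonneg[of x z] A by auto
  qed
  with A show "x \<in> A \<and> y \<in> A \<and> D x y = 0" by simp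
next
  assume "x \<in> A \<and> y \<in> A \<and> D x y = 0"
  then show "(x, y) \<in> E" using D_sep by (auto simp: generated_equiv_def)
qed

lemma class_eq_iff: "x \<in> A \<Longrightarrow> y \<in> A \<Longrightarrow> E `` {x} = E `` {y} \<longleftrightarrow> D x y = 0"
  by (simp add: generated_equiv_class_eq_iff rel_iff)

text \<open>Makes \<open>D\<close> well defined on classes. This evaluates the definite descriptions
  in \<open>tensor_dst\<close> and in the metric of \<open>G\<close> at any chosen
  representatives.\<close>

lemma D_cong:
  assumes "(x, x') \<in> E" "(y, y') \<in> E"
  shows "D x' y' = D x y"
proof -
  have A: "x \<in> A" "x' \<in> A" "y \<in> A" "y' \<in> A" and Z: "D x x' = 0" "D y y' = 0"
    using assms by (auto simp: rel_iff)
  show ?thesis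
    using D_triangle[of x x' y] D_triangle[of x' x y] D_triangle[of x' y y'] D_triangle[of x' y' y]
      D_sym[of x x'] D_sym[of y y'] A Z by linarith
qed

text \<open>The default value in \<open>d0\<close> supplies nonnegativity and symmetry for arguments
  that are not classes, which \<open>Metric_space\<close> demands as well.\<close>

lemma metric_quotient:
  assumes d: "\<And>x y. x \<in> A \<Longrightarrow> y \<in> A \<Longrightarrow> d (E `` {x}) (E `` {y}) = D x y"
    and d0: "\<And>P Q. \<not> (P \<in> A // E \<and> Q \<in> A // E) \<Longrightarrow> d P Q = 0"
  shows "Metric_space (A // E) d"
proof
  fix P Q
  show "0 \<le> d P Q"
    by (cases "P \<in> A // E \<and> Q \<in> A // E") (auto elim!: quotientE simp: d D_nonneg d0)
  show "d P Q = d Q P"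
  proof (cases "P \<in> A // E \<and> Q \<in> A // E")
    case True
    then show ?thesis by (auto elim!: quotientE simp: d intro: D_sym)
  next
    case False
    then show ?thesis using d0[of P Q] d0[of Q P] by auto
  qed
  show "d P Q = 0 \<longleftrightarrow> P = Q" if "P \<in> A // E" "Q \<in> A // E"
    using that by (elim quotientE) (simp add: d class_eq_iff)
  show "d P S \<le> d P Q + d Q S" if "P \<in> A // E" "Q \<in> A // E" "S \<in> A // E" for S
    using that by (auto elim!: quotientE simp: d intro: D_triangle)
qed

end


section \<open>The tensor\<close>

lemma tensor_simps [simp]:
  "carrier (tensor X) = (UNIV \<times> carrier X) // tensor_rel X"
  "Tpt (tensor X) = tensor_elem X Ca (Tpt X)"
  "Lpt (tensor X) = tensor_elem X Cb (Lpt X)"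
  "Rpt (tensor X) = tensor_elem X Cc (Rpt X)"
  "carrier (tensor_met Z) = (UNIV \<times> carrier Z) // tensor_rel Z"
  "Tpt (tensor_met Z) = tensor_elem Z Ca (Tpt Z)"
  "Lpt (tensor_met Z) = tensor_elem Z Cb (Lpt Z)"
  "Rpt (tensor_met Z) = tensor_elem Z Cc (Rpt Z)"
  "dst (tensor_met Z) = tensor_dst Z"
  by (simp_all add: tensor_def tensor_met_def)

lemma tensor_elem_in [intro]: "x \<in> carrier X \<Longrightarrow> tensor_elem X m x \<in> (UNIV \<times> carrier X) // tensor_rel X"
  by (simp add: tensor_elem_def quotientI)

lemma tensor_carrierE:
  assumes "C \<in> (UNIV \<times> carrier X) // tensor_rel X"
  obtains m x where "x \<in> carrier X" "C = tensor_elem X m x"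
  using assms by (auto simp: tensor_elem_def elim!: quotientE)

lemma tensor_elem_eq_iff:
  assumes "x \<in> carrier X" "y \<in> carrier X"
  shows "tensor_elem X m x = tensor_elem X n y \<longleftrightarrow> ((m, x), (n, y)) \<in> tensor_rel X"
  using assms by (simp add: tensor_elem_def tensor_rel_def generated_equiv_class_eq_iff)

lemma mem_tensor_elem_iff: "p \<in> tensor_elem X m x \<longleftrightarrow> ((m, x), p) \<in> tensor_rel X"
  by (simp add: tensor_elem_def)

lemma tensor_rel_carrier: "((m, x), (n, y)) \<in> tensor_rel X \<Longrightarrow> x \<in> carrier X \<and> y \<in> carrier X"
  by (auto simp: tensor_rel_def generated_equiv_def)

lemma tensor_elem_self [simp]: "x \<in> carrier X \<Longrightarrow> (m, x) \<in> tensor_elem X m x"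
  by (simp add: tensor_elem_def tensor_rel_def generated_equiv_def)

text \<open>\<open>set_hom\<close> without extensionality: the chain maps, the maps
  \<open>colim_class n\<close> and the stage maps below are total functions that need not be
  \<open>undefined\<close> off the carriers.\<close>

definition preserves_points :: "('a, 'y) tri_scheme \<Rightarrow> ('b, 'z) tri_scheme \<Rightarrow> ('a \<Rightarrow> 'b) \<Rightarrow> bool" where
  "preserves_points X Y f \<longleftrightarrow>
     f \<in> carrier X \<rightarrow> carrier Y \<and> f (Tpt X) = Tpt Y \<and> f (Lpt X) = Lpt Y \<and> f (Rpt X) = Rpt Y"

lemma set_hom_iff: "f \<in> set_hom X Y \<longleftrightarrow> preserves_points X Y f \<and> f \<in> extensional (carrier X)"
  by (auto simp: set_hom_def preserves_points_def PiE_def)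

section \<open>The action of the tensor on maps\<close>

definition tensor_gen :: "('a, 'z) tri_scheme \<Rightarrow> (cell \<times> 'a) rel" where
  "tensor_gen X =
    {((Cb, Tpt X), (Ca, Lpt X)), ((Ca, Rpt X), (Cc, Tpt X)), ((Cc, Lpt X), (Cb, Rpt X))}"

lemma tensor_rel_eq: "tensor_rel X = generated_equiv (UNIV \<times> carrier X) (tensor_gen X)"
  by (simp add: tensor_rel_def tensor_gen_def)

text \<open>A point-preserving map sends each gluing pair of \<open>X\<close> to the corresponding
  gluing pair of \<open>Y\<close>, and so paths of gluings to paths of gluings.\<close>

lemma tensor_rel_map:
  assumes f: "preserves_points X Y f" and p: "((m, x), (n, y)) \<in> tensor_rel X"
  shows "((m, f x), (n, f y)) \<in> tensor_rel Y"
proof -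
  have gen: "(map_prod id f p, map_prod id f q) \<in> tensor_gen Y \<union> (tensor_gen Y)\<inverse>"
    if "(p, q) \<in> tensor_gen X \<union> (tensor_gen X)\<inverse>" for p q
    using that f unfolding tensor_gen_def preserves_points_def by (elim UnE; force)
  have "(map_prod id f p, map_prod id f q) \<in> (tensor_gen Y \<union> (tensor_gen Y)\<inverse>)\<^sup>*"
    if "(p, q) \<in> (tensor_gen X \<union> (tensor_gen X)\<inverse>)\<^sup>*" for p q
    using that
  proof (induction rule: rtrancl_induct)
    case (step p q)
    then show ?case using gen[of p q] by (meson rtrancl_into_rtrancl)
  qed simp
  from this[of "(m, x)" "(n, y)"] show ?thesis
    using p f unfolding tensor_rel_eq generated_equiv_def preserves_points_def by (simp add: Pi_iff)
qed

lemma tensor_map_elem: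
  assumes f: "preserves_points X Y f" and x: "x \<in> carrier X"
  shows "tensor_map X Y f (tensor_elem X m x) = tensor_elem Y m (f x)"
proof -
  have *: "tensor_elem Y n (f y) = tensor_elem Y m (f x)" if "(n, y) \<in> tensor_elem X m x" for n y
  proof -
    have "((m, x), (n, y)) \<in> tensor_rel X" "y \<in> carrier X"
      using that tensor_rel_carrier by (simp add: mem_tensor_elem_iff, metis mem_tensor_elem_iff)
    then show ?thesis
      using tensor_rel_map[OF f] tensor_elem_eq_iff[of "f x" Y "f y" m n] f x
      by (auto simp: preserves_points_def Pi_iff)
  qed
  have "tensor_map X Y f (tensor_elem X m x) = (\<Union>(n, y)\<in>tensor_elem X m x. tensor_elem Y n (f y))"
    using tensor_elem_in[OF x] by (simp add: tensor_map_def)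
  also have "\<dots> = (\<Union>p\<in>tensor_elem X m x. tensor_elem Y m (f x))"
    by (rule SUP_cong) (auto simp: *)
  also have "\<dots> = tensor_elem Y m (f x)"
    using tensor_elem_self[OF x, of m] by blast
  finally show ?thesis .
qed

text \<open>The formulas involve only distances in \<open>X\<close> to and between arguments and
  distinguished points, all of which \<open>f\<close> respects. This drives both the isometry of the
  chain maps and the computation of distances in \<open>G\<close>.\<close>

lemma tensor_dst_rep_map:
  assumes "preserves_points X Y f" "x \<in> carrier X" "y \<in> carrier X" "tripointed X"
    and "\<And>x y. x \<in> carrier X \<Longrightarrow> y \<in> carrier X \<Longrightarrow> dst Y (f x) (f y) = dst X x y"
  shows "tensor_dst_rep Y (m, f x) (n, f y) = tensor_dst_rep X (m, x) (n, y)"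
proof -
  have "Tpt Y = f (Tpt X)" "Lpt Y = f (Lpt X)" "Rpt Y = f (Rpt X)"
    and "Tpt X \<in> carrier X" "Lpt X \<in> carrier X" "Rpt X \<in> carrier X"
    using assms by (auto simp: preserves_points_def tripointed_def)
  then show ?thesis using assms(2,3,5) by (cases m; cases n) simp_all
qed

section \<open>The quotient metric of the tensor\<close>

lemma tripointed_metricD:
  assumes "tripointed_metric X"
  shows "Tpt X \<in> carrier X" "Lpt X \<in> carrier X" "Rpt X \<in> carrier X"
    and "Metric_space (carrier X) (dst X)" "tripointed X"
    and "\<And>x y. x \<in> carrier X \<Longrightarrow> y \<in> carrier X \<Longrightarrow> dst X x y \<le> 1"
    and "dst X (Tpt X) (Lpt X) = 1" "dst X (Tpt X) (Rpt X) = 1" "dst X (Lpt X) (Rpt X) = 1"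
    and "dst X (Lpt X) (Tpt X) = 1" "dst X (Rpt X) (Tpt X) = 1" "dst X (Rpt X) (Lpt X) = 1"
    and "\<And>x y. 0 \<le> dst X x y" "\<And>x y. dst X x y = dst X y x"
    and "\<And>x y. x \<in> carrier X \<Longrightarrow> y \<in> carrier X \<Longrightarrow> dst X x y = 0 \<longleftrightarrow> x = y"
    and "\<And>x y z. x \<in> carrier X \<Longrightarrow> y \<in> carrier X \<Longrightarrow> z \<in> carrier X \<Longrightarrow> dst X x z \<le> dst X x y + dst X y z"
    and "\<And>x. x \<in> carrier X \<Longrightarrow> dst X x x = 0"
  using assms unfolding tripointed_metric_def tripointed_def Metric_space_def by metis+

text \<open>The point of cell \<open>m\<close> that is glued to cell \<open>n\<close> (arbitrary if \<open>m = n\<close>). It makes the formulas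
  for the metric uniform in the cells: a path from one cell to another goes directly through their
  junction or through the third cell, whose two junctions are at distance 1.\<close>

fun junction :: "('a, 'z) tri_scheme \<Rightarrow> cell \<Rightarrow> cell \<Rightarrow> 'a" where
  "junction X Ca Cb = Lpt X"
| "junction X Ca Cc = Rpt X"
| "junction X Cb Ca = Tpt X"
| "junction X Cb Cc = Rpt X"
| "junction X Cc Ca = Tpt X"
| "junction X Cc Cb = Lpt X"
| "junction X Ca Ca = Tpt X"
| "junction X Cb Cb = Lpt X"
| "junction X Cc Cc = Rpt X"

lemma tensor_dst_rep_same: "tensor_dst_rep X (m, x) (m, y) = dst X x y / 2"
  by (cases m) simp_all

lemma tensor_dst_rep_distinct:
  assumes X: "tripointed_metric X" and "m \<noteq> n" "n \<noteq> p" "m \<noteq> p"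
  shows "tensor_dst_rep X (m, x) (n, y) =
    min (dst X x (junction X m n) + dst X (junction X n m) y)
        (dst X x (junction X m p) + 1 + dst X (junction X n p) y) / 2"
  using assms(2-) tripointed_metricD(14)[OF X]
  by (cases m; cases n; cases p) (simp_all add: add.commute add.left_commute)

lemma junction_in: "tripointed_metric X \<Longrightarrow> junction X m n \<in> carrier X"
  using tripointed_metricD(1-3) by (cases m; cases n) auto

lemma dst_junction:
  assumes X: "tripointed_metric X" and "n \<noteq> p"
  shows "dst X (junction X m n) (junction X m p) = 1"
  using tripointed_metricD(7-12)[OF X] assms(2) by (cases m; cases n; cases p) simp_all

lemma other_cell: obtains p :: cell where "p \<noteq> m" "p \<noteq> n"
  by (metis cell.distinct(1) cell.distinct(3) cell.distinct(5))

lemma tensor_dst_rep_sym: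
  assumes X: "tripointed_metric X"
  shows "tensor_dst_rep X (m, x) (n, y) = tensor_dst_rep X (n, y) (m, x)"
  using tripointed_metricD(14)[OF X] by (cases m; cases n) simp_all

text \<open>For the triangle inequality: \<open>a\<close>, \<open>a'\<close> are the lengths of the
  two routes for the first leg and \<open>b\<close>, \<open>b'\<close> those for the second, so four
  combinations have to be bounded.\<close>

lemma half_le_half_min_add:
  fixes c :: real
  assumes "c \<le> a + b" "c \<le> a + b'" "c \<le> a' + b" "c \<le> a' + b'"
  shows "c / 2 \<le> min a a' / 2 + min b b' / 2"
  using assms by (simp add: min_def)

lemma tensor_dst_rep_triangle:
  assumes X: "tripointed_metric X" and c: "x \<in> carrier X" "y \<in> carrier X" "z \<in> carrier X"
  shows "tensor_dst_rep X (m, x) (p, z) \<le> tensor_dst_rep X (m, x) (n, y) + tensor_dst_rep X (n, y) (p, z)"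
proof -
  note M = tripointed_metricD[OF X]
  note tri = M(16) and com = M(14) and J = junction_in[OF X]
  note rep = tensor_dst_rep_distinct[OF X]
  consider "m = n" "n = p" | "m = n" "n \<noteq> p" | "m \<noteq> n" "n = p" | "m \<noteq> n" "m = p" | "m \<noteq> n" "n \<noteq> p" "m \<noteq> p"
    by metis
  then show ?thesis
  proof cases
    case 1
    then show ?thesis using tri[OF c] by (simp add: tensor_dst_rep_same)
  next
    case 2
    then obtain k where k: "k \<noteq> n" "k \<noteq> p" using other_cell by metis
    have "dst X x (junction X n s) \<le> dst X x y + dst X y (junction X n s)" for s
      using tri c J by auto
    from this[of p] this[of k] show ?thesis
      using 2 k by (simp add: tensor_dst_rep_same rep[of n p k])
  next
    case 3
    then obtain k where k: "k \<noteq> n" "k \<noteq> m" using other_cell by metis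
    have "dst X (junction X n s) z \<le> dst X (junction X n s) y + dst X y z" for s
      using tri c J by auto
    from this[of m] this[of k] show ?thesis
      using 3 k by (simp add: tensor_dst_rep_same rep[of m p k])
  next
    \<comment> \<open>The path leaves cell \<open>m\<close> and returns. If it uses the same
      junction of \<open>m\<close> both ways, the triangle inequality in \<open>m\<close> suffices.
      Otherwise it meets two different junctions of cell \<open>n\<close> around \<open>y\<close>,
      which costs at least 1, and 1 bounds \<open>dst X x z\<close>.\<close>
    case 4
    then obtain k where k: "k \<noteq> n" "k \<noteq> m" using other_cell by metis
    have a: "dst X x z \<le> dst X x (junction X m s) + dst X (junction X m s) z" for s
      using tri c J by auto
    have b: "1 \<le> dst X (junction X n m) y + dst X y (junction X n k)"
      "1 \<le> dst X (junction X n k) y + dst X y (junction X n m)"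
      using tri[of "junction X n m" y "junction X n k"] tri[of "junction X n k" y "junction X n m"]
        dst_junction[OF X, of m k n] dst_junction[OF X, of k m n] k c J by auto
    have nn: "0 \<le> dst X s t" "dst X x z \<le> 1" for s t using M(6,13) c by auto
    show ?thesis
      unfolding 4(2)[symmetric] tensor_dst_rep_same rep[OF 4(1) k(1)[symmetric] k(2)[symmetric]]
        rep[OF 4(1)[symmetric] k(2)[symmetric] k(1)[symmetric]]
    proof (rule half_le_half_min_add)
      show "dst X x z \<le> dst X x (junction X m n) + dst X (junction X n m) y +
          (dst X y (junction X n m) + dst X (junction X m n) z)"
        using a[of n] nn(1)[of "junction X n m" y] nn(1)[of y "junction X n m"] by linarith
      show "dst X x z \<le> dst X x (junction X m n) + dst X (junction X n m) y +
          (dst X y (junction X n k) + 1 + dst X (junction X m k) z)"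
        using b(1) nn(2) nn(1)[of x "junction X m n"] nn(1)[of "junction X m k" z] by linarith
      show "dst X x z \<le> dst X x (junction X m k) + 1 + dst X (junction X n k) y +
          (dst X y (junction X n m) + dst X (junction X m n) z)"
        using b(2) nn(2) nn(1)[of x "junction X m k"] nn(1)[of "junction X m n" z] by linarith
      show "dst X x z \<le> dst X x (junction X m k) + 1 + dst X (junction X n k) y +
          (dst X y (junction X n k) + 1 + dst X (junction X m k) z)"
        using a[of k] nn(1)[of "junction X n k" y] nn(1)[of y "junction X n k"] by linarith
    qed
  next
    case 5
    \<comment> \<open>Two direct legs cross cell \<open>n\<close> between different junctions; by
      \<open>b\<close> they are at least as long as the route from \<open>m\<close> to
      \<open>p\<close> through \<open>n\<close>. The other three combinations are compared with the
      direct route from \<open>m\<close> to \<open>p\<close>, where by \<open>e\<close> changing the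
      junction inside \<open>m\<close> or \<open>p\<close> costs at most 1.\<close>
    have b: "1 \<le> dst X (junction X n m) y + dst X y (junction X n p)"
      using tri[of "junction X n m" y "junction X n p"]
        dst_junction[OF X, of m p n] 5 c J by auto
    have e: "dst X x (junction X m p) \<le> dst X x (junction X m n) + 1"
      "dst X (junction X p m) z \<le> 1 + dst X (junction X p n) z"
      using tri[of x "junction X m n" "junction X m p"] tri[of "junction X p m" "junction X p n" z]
        dst_junction[OF X, of n p m] dst_junction[OF X, of m n p] 5 c J by auto
    have nn: "0 \<le> dst X s t" for s t using M(13) .
    show ?thesis
      unfolding rep[OF 5] rep[OF 5(2) 5(3)[symmetric] 5(1)[symmetric]]
        rep[OF 5(3) 5(2)[symmetric] 5(1)]
    proof (rule half_le_half_min_add)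
      show "min (dst X x (junction X m p) + dst X (junction X p m) z)
            (dst X x (junction X m n) + 1 + dst X (junction X p n) z)
          \<le> dst X x (junction X m n) + dst X (junction X n m) y +
            (dst X y (junction X n p) + dst X (junction X p n) z)"
        by (rule min.coboundedI2) (use b in linarith)
      show "min (dst X x (junction X m p) + dst X (junction X p m) z)
            (dst X x (junction X m n) + 1 + dst X (junction X p n) z)
          \<le> dst X x (junction X m n) + dst X (junction X n m) y +
            (dst X y (junction X n m) + 1 + dst X (junction X p m) z)"
        by (rule min.coboundedI1)
          (use e(1) nn[of "junction X n m" y] nn[of y "junction X n m"] in linarith)
      show "min (dst X x (junction X m p) + dst X (junction X p m) z)
            (dst X x (junction X m n) + 1 + dst X (junction X p n) z)
          \<le> dst X x (junction X m p) + 1 + dst X (junction X n p) y +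
            (dst X y (junction X n p) + dst X (junction X p n) z)"
        by (rule min.coboundedI1)
          (use e(2) nn[of "junction X n p" y] nn[of y "junction X n p"] in linarith)
      show "min (dst X x (junction X m p) + dst X (junction X p m) z)
            (dst X x (junction X m n) + 1 + dst X (junction X p n) z)
          \<le> dst X x (junction X m p) + 1 + dst X (junction X n p) y +
            (dst X y (junction X n m) + 1 + dst X (junction X p m) z)"
        by (rule min.coboundedI1)
          (use nn[of "junction X n p" y] nn[of y "junction X n m"] in linarith)
    qed
  qed
qed
lemma junction_tensor_gen:
  "m \<noteq> n \<Longrightarrow> ((m, junction X m n), (n, junction X n m)) \<in> tensor_gen X \<union> (tensor_gen X)\<inverse>"
  by (cases m; cases n) (simp_all add: tensor_gen_def)

text \<open>For \<open>D_sep\<close>: the route through the third cell contributes at least 1/2, so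
  distance 0 between different cells comes from the direct route. Both points are then the junction
  points, and a single gluing relates them. Within one cell, distance 0 means equality.\<close>

lemma pseudometric_quotient_tensor:
  assumes X: "tripointed_metric X"
  shows "pseudometric_quotient (UNIV \<times> carrier X) (tensor_gen X) (tensor_dst_rep X)"
proof
  note M = tripointed_metricD[OF X]
  show "tensor_gen X \<subseteq> (UNIV \<times> carrier X) \<times> (UNIV \<times> carrier X)"
    using M by (auto simp: tensor_gen_def)
  fix p q :: "cell \<times> 'a" assume p: "p \<in> UNIV \<times> carrier X"
  then show "tensor_dst_rep X p p = 0"
    using M(15) by (auto simp: tensor_dst_rep_same)
  assume q: "q \<in> UNIV \<times> carrier X"
  show "0 \<le> tensor_dst_rep X p q"
    using M(13) by (cases p; cases q; cases "fst p"; cases "fst q") simp_all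
  show "tensor_dst_rep X p q = tensor_dst_rep X q p"
    using tensor_dst_rep_sym[OF X] by (cases p; cases q) simp
  show "tensor_dst_rep X p s \<le> tensor_dst_rep X p q + tensor_dst_rep X q s" if "s \<in> UNIV \<times> carrier X" for s
    using that p q tensor_dst_rep_triangle[OF X] by auto
  show "(p, q) \<in> (tensor_gen X \<union> (tensor_gen X)\<inverse>)\<^sup>*" if z: "tensor_dst_rep X p q = 0"
  proof -
    obtain m x n y where pq: "p = (m, x)" "q = (n, y)" and c: "x \<in> carrier X" "y \<in> carrier X"
      using p q by auto
    show ?thesis
    proof (cases "m = n")
      case True
      then show ?thesis using z M(15) c pq by (simp add: tensor_dst_rep_same)
    next
      case False
      then obtain k where k: "k \<noteq> m" "k \<noteq> n" using other_cell by metis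
      have "dst X x (junction X m n) + dst X (junction X n m) y = 0"
        using z M(13)[of x "junction X m k"] M(13)[of "junction X n k" y] False k
        unfolding pq by (simp add: tensor_dst_rep_distinct[OF X, of m n k] min_def split: if_splits)
      then have "dst X x (junction X m n) = 0" "dst X (junction X n m) y = 0"
        using M(13)[of x "junction X m n"] M(13)[of "junction X n m" y] by linarith+
      then have "x = junction X m n" "y = junction X n m"
        using M(15) junction_in[OF X] c by metis+
      then show ?thesis
        using junction_tensor_gen[OF False, of X] pq by blast
    qed
  qed
next
  fix p q assume "(p, q) \<in> tensor_gen X"
  then show "tensor_dst_rep X p q = 0"
    using tripointed_metricD(1-3,7-12,17)[OF X] by (auto simp: tensor_gen_def)
qed

lemma tensor_dst_elem:
  assumes X: "tripointed_metric X" and c: "x \<in> carrier X" "y \<in> carrier X"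
  shows "tensor_dst X (tensor_elem X m x) (tensor_elem X n y) = tensor_dst_rep X (m, x) (n, y)"
proof -
  have *: "tensor_dst_rep X p q = tensor_dst_rep X (m, x) (n, y)"
    if "p \<in> tensor_elem X m x" "q \<in> tensor_elem X n y" for p q
    using pseudometric_quotient.D_cong[OF pseudometric_quotient_tensor[OF X]] that
    by (simp add: tensor_elem_def tensor_rel_eq)
  have "(THE r. \<exists>p\<in>tensor_elem X m x. \<exists>q\<in>tensor_elem X n y. r = tensor_dst_rep X p q)
      = tensor_dst_rep X (m, x) (n, y)"
  proof (rule the_equality)
    show "\<exists>p\<in>tensor_elem X m x. \<exists>q\<in>tensor_elem X n y. tensor_dst_rep X (m, x) (n, y) = tensor_dst_rep X p q"
      using c by (intro bexI[where x = "(m, x)"] bexI[where x = "(n, y)"]) simp_all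
    show "r = tensor_dst_rep X (m, x) (n, y)"
      if "\<exists>p\<in>tensor_elem X m x. \<exists>q\<in>tensor_elem X n y. r = tensor_dst_rep X p q" for r
      using that * by (elim bexE) simp
  qed
  then show ?thesis using c by (simp add: tensor_dst_def tensor_elem_in)
qed

text \<open>The direct route has two parts of length at most 1, and the sum is halved.\<close>

lemma tensor_dst_rep_le_1:
  assumes X: "tripointed_metric X" and c: "x \<in> carrier X" "y \<in> carrier X"
  shows "tensor_dst_rep X (m, x) (n, y) \<le> 1"
proof (cases "m = n")
  case True
  then show ?thesis using tripointed_metricD(6)[OF X c] by (simp add: tensor_dst_rep_same)
next
  case False
  then obtain k where k: "k \<noteq> m" "k \<noteq> n" using other_cell by metis
  show ?thesis
    using tripointed_metricD(6)[OF X c(1) junction_in[OF X], of m n]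
      tripointed_metricD(6)[OF X junction_in[OF X] c(2), of n m] False k
    by (simp add: tensor_dst_rep_distinct[OF X, of m n k])
qed

lemma tripointed_metric_tensor:
  assumes X: "tripointed_metric X"
  shows "tripointed_metric (tensor_met X)"
proof -
  note M = tripointed_metricD[OF X]
  have "Metric_space ((UNIV \<times> carrier X) // tensor_rel X) (tensor_dst X)"
    unfolding tensor_rel_eq
  proof (rule pseudometric_quotient.metric_quotient[OF pseudometric_quotient_tensor[OF X]], goal_cases)
    case (1 p q)
    then show ?case using tensor_dst_elem[OF X] by (auto simp: tensor_elem_def tensor_rel_eq)
  next
    case (2 P Q)
    then show ?case by (auto simp: tensor_dst_def tensor_rel_eq)
  qed
  moreover have "tensor_dst X C D \<le> 1"
    if "C \<in> (UNIV \<times> carrier X) // tensor_rel X" "D \<in> (UNIV \<times> carrier X) // tensor_rel X" for C D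
    using that tensor_dst_rep_le_1[OF X] by (auto elim!: tensor_carrierE simp: tensor_dst_elem[OF X])
  ultimately show ?thesis
    using M unfolding tripointed_metric_def tripointed_def
    by (simp add: tensor_dst_elem[OF X] tensor_elem_in)
qed


section \<open>The iterates\<close>

lemma tripointed_metric_relabel:
  assumes X: "tripointed_metric X" and h: "inj_on h (carrier X)"
  shows "tripointed_metric (relabel h X)"
proof -
  note M = tripointed_metricD[OF X]
  have "Metric_space (h ` carrier X) (dst (relabel h X))"
    by unfold_locales (use M h in \<open>auto simp: relabel_def inj_on_def\<close>)
  then show ?thesis
    using M h unfolding tripointed_metric_def tripointed_def by (auto simp: relabel_def)
qed

lemma dst_relabel:
  assumes "inj_on h (carrier X)" "x \<in> carrier X" "y \<in> carrier X"
  shows "dst (relabel h X) (h x) (h y) = dst X x y"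
  using assms by (simp add: relabel_def)

lemma tripointed_metric_I3: "tripointed_metric I3"
proof -
  have "Metric_space (carrier I3) (dst I3)"
    by unfold_locales (auto simp: I3_def)
  then show ?thesis
    unfolding tripointed_metric_def tripointed_def by (auto simp: I3_def)
qed

lemma carrier_I3: "carrier I3 = {Tpt I3, Lpt I3, Rpt I3}"
  using corner.exhaust by (auto simp: I3_def)

text \<open>The classes in an iterate are disjoint and nonempty, which makes \<open>flatten\<close> injective on the
  classes of the next tensor.\<close>

definition partition_carrier :: "'a set tri_met \<Rightarrow> bool" where
  "partition_carrier X \<longleftrightarrow> {} \<notin> carrier X \<and> disjoint (carrier X)"

lemma flatten_mem_iff:
  "(v, i) \<in> flatten C \<longleftrightarrow> (\<exists>m w D. v = m # w \<and> (m, D) \<in> C \<and> (w, i) \<in> D)"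
  by (auto simp: flatten_def)

lemma tensor_class_subset:
  "C \<in> (UNIV \<times> carrier X) // tensor_rel X \<Longrightarrow> C \<subseteq> UNIV \<times> carrier X"
  by (auto simp: quotient_def tensor_rel_def generated_equiv_def)

text \<open>A common word has one head and one tail, and the tail lies in only one class of
  \<open>X\<close>; so the two tensor classes share a pair. Disjointness is stronger than
  injectivity of \<open>flatten\<close> and is what carries \<open>partition_carrier\<close> to the
  next iterate.\<close>

lemma flatten_disjoint:
  assumes X: "partition_carrier X"
    and C: "C \<in> (UNIV \<times> carrier X) // tensor_rel X" "C' \<in> (UNIV \<times> carrier X) // tensor_rel X"
    and meet: "flatten C \<inter> flatten C' \<noteq> {}"
  shows "C = C'"
proof -
  obtain v i where "(v, i) \<in> flatten C" "(v, i) \<in> flatten C'" using meet by auto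
  then obtain m w D D' where D: "(m, D) \<in> C" "(m, D') \<in> C'" "(w, i) \<in> D" "(w, i) \<in> D'"
    by (auto simp: flatten_mem_iff)
  then have "D \<in> carrier X" "D' \<in> carrier X"
    using C tensor_class_subset by blast+
  then have "D = D'" using X D by (auto simp: partition_carrier_def disjoint_def)
  then have "C \<inter> C' \<noteq> {}" using D by auto
  moreover have "disjoint ((UNIV \<times> carrier X) // tensor_rel X)"
    unfolding disjoint_def tensor_rel_def by (meson quotient_disj equiv_generated_equiv)
  ultimately show ?thesis using C by (auto simp: disjoint_def)
qed

lemma flatten_nonempty:
  assumes X: "partition_carrier X" and C: "C \<in> (UNIV \<times> carrier X) // tensor_rel X"
  shows "flatten C \<noteq> {}"
proof -
  obtain m x where x: "x \<in> carrier X" "C = tensor_elem X m x" using C by (rule tensor_carrierE)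
  then have "x \<noteq> {}" using X by (auto simp: partition_carrier_def)
  then obtain w i where "(w, i) \<in> x" by auto
  then have "(m # w, i) \<in> flatten C" using x by (auto simp: flatten_mem_iff)
  then show ?thesis by auto
qed

lemma inj_on_flatten:
  assumes "partition_carrier X"
  shows "inj_on flatten ((UNIV \<times> carrier X) // tensor_rel X)"
  using flatten_disjoint[OF assms] flatten_nonempty[OF assms] by (intro inj_onI) auto

lemma partition_carrier_relabel_flatten:
  assumes "partition_carrier X"
  shows "partition_carrier (relabel flatten (tensor_met X))"
  using flatten_disjoint[OF assms] flatten_nonempty[OF assms]
  unfolding partition_carrier_def disjoint_def relabel_def by auto blast+

lemma partition_carrier_iter: "partition_carrier (iter n)"
proof (induction n)
  case 0
  then show ?case by (auto simp: I3_def partition_carrier_def disjoint_def)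
next
  case (Suc n)
  then show ?case by (simp add: partition_carrier_relabel_flatten)
qed

lemma inj_on_flatten_iter: "inj_on flatten ((UNIV \<times> carrier (iter n)) // tensor_rel (iter n))"
  by (rule inj_on_flatten[OF partition_carrier_iter])

lemma tripointed_metric_iter: "tripointed_metric (iter n)"
proof (induction n)
  case (Suc n)
  then show ?case
    using inj_on_flatten_iter[of n] by (simp add: tripointed_metric_relabel tripointed_metric_tensor)
qed (simp add: tripointed_metric_I3)

lemma iter_elem_in: "\<xi> \<in> carrier (iter n) \<Longrightarrow> iter_elem n m \<xi> \<in> carrier (iter (Suc n))"
  by (auto simp: iter_elem_def relabel_def)

lemma iter_SucE:
  assumes "\<zeta> \<in> carrier (iter (Suc n))"
  obtains m \<xi> where "\<xi> \<in> carrier (iter n)" "\<zeta> = iter_elem n m \<xi>"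
  using assms by (auto simp: iter_elem_def relabel_def elim!: tensor_carrierE)

lemma iter_Suc_points:
  "Tpt (iter (Suc n)) = iter_elem n Ca (Tpt (iter n))"
  "Lpt (iter (Suc n)) = iter_elem n Cb (Lpt (iter n))"
  "Rpt (iter (Suc n)) = iter_elem n Cc (Rpt (iter n))"
  by (simp_all add: relabel_def iter_elem_def)

lemma dst_iter_elem:
  assumes "\<xi> \<in> carrier (iter n)" "\<eta> \<in> carrier (iter n)"
  shows "dst (iter (Suc n)) (iter_elem n m \<xi>) (iter_elem n k \<eta>) = tensor_dst_rep (iter n) (m, \<xi>) (k, \<eta>)"
  using assms inj_on_flatten_iter[of n]
  by (simp add: iter_elem_def dst_relabel tensor_elem_in tensor_dst_elem[OF tripointed_metric_iter])

lemma iter_elem_eq_iff: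
  assumes "\<xi> \<in> carrier (iter n)" "\<eta> \<in> carrier (iter n)"
  shows "iter_elem n m \<xi> = iter_elem n k \<eta> \<longleftrightarrow> ((m, \<xi>), (k, \<eta>)) \<in> tensor_rel (iter n)"
  using assms inj_on_eq_iff[OF inj_on_flatten_iter[of n], of "tensor_elem (iter n) m \<xi>" "tensor_elem (iter n) k \<eta>"]
  by (simp add: iter_elem_def tensor_elem_eq_iff tensor_elem_in)

section \<open>The chain maps as isometric embeddings\<close>

definition isometric_embedding :: "'a tri_met \<Rightarrow> 'b tri_met \<Rightarrow> ('a \<Rightarrow> 'b) \<Rightarrow> bool" where
  "isometric_embedding X Y f \<longleftrightarrow> preserves_points X Y f \<and>
     (\<forall>x\<in>carrier X. \<forall>y\<in>carrier X. dst Y (f x) (f y) = dst X x y)"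

text \<open>The premise on \<open>chain n\<close> stays explicit because
  \<open>isometric_embedding_chain\<close> establishes it in the very induction that uses this
  equation.\<close>

lemma chain_Suc:
  assumes f: "preserves_points (iter n) (iter (Suc n)) (chain n)" and \<xi>: "\<xi> \<in> carrier (iter n)"
  shows "chain (Suc n) (iter_elem n m \<xi>) = iter_elem (Suc n) m (chain n \<xi>)"
proof -
  have "inv_into ((UNIV \<times> carrier (iter n)) // tensor_rel (iter n)) flatten (flatten (tensor_elem (iter n) m \<xi>))
      = tensor_elem (iter n) m \<xi>"
    using \<xi> by (intro inv_into_f_f inj_on_flatten_iter tensor_elem_in)
  then show ?thesis
    using tensor_map_elem[OF f \<xi>, of m] by (simp add: iter_elem_def del: iter.simps)
qed

text \<open>Stage 0 consists of the distinguished points alone, whose mutual distances are 1 at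
  every stage. The step holds because distances in the tensor are computed from those one stage
  below (\<open>tensor_dst_rep_map\<close>).\<close>

lemma isometric_embedding_chain: "isometric_embedding (iter n) (iter (Suc n)) (chain n)"
proof (induction n)
  case 0
  note I = tripointed_metricD[OF tripointed_metric_I3]
  have b: "bang (Tpt I3) = Tpt (iter (Suc 0))" "bang (Lpt I3) = Lpt (iter (Suc 0))"
    "bang (Rpt I3) = Rpt (iter (Suc 0))"
    unfolding iter_Suc_points by (auto simp: bang_def I3_def)
  note S = tripointed_metricD[OF tripointed_metric_iter[of "Suc 0"]]
  show ?case
    unfolding isometric_embedding_def preserves_points_def iter.simps(1) chain.simps(1) carrier_I3
    using b S(1-3,7-12,17) I(1-3,7-12,17) by (auto simp del: iter.simps)
next
  case (Suc n)
  then have p: "preserves_points (iter n) (iter (Suc n)) (chain n)"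
    and d: "\<And>\<xi> \<eta>. \<xi> \<in> carrier (iter n) \<Longrightarrow> \<eta> \<in> carrier (iter n) \<Longrightarrow>
      dst (iter (Suc n)) (chain n \<xi>) (chain n \<eta>) = dst (iter n) \<xi> \<eta>"
    by (auto simp: isometric_embedding_def simp del: iter.simps)
  have q: "chain n \<xi> \<in> carrier (iter (Suc n))" if "\<xi> \<in> carrier (iter n)" for \<xi>
    using that p by (auto simp: preserves_points_def)
  note c = chain_Suc[OF p]
  note I = tripointed_metricD[OF tripointed_metric_iter[of n]]
  have 1: "chain (Suc n) \<in> carrier (iter (Suc n)) \<rightarrow> carrier (iter (Suc (Suc n)))"
    by (auto elim!: iter_SucE simp: c q iter_elem_in simp del: iter.simps chain.simps)
  have "preserves_points (iter (Suc n)) (iter (Suc (Suc n))) (chain (Suc n))"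
    using 1 p I unfolding preserves_points_def iter_Suc_points[of "Suc n"]
    unfolding iter_Suc_points[of n] by (simp add: c del: iter.simps chain.simps)
  moreover have "dst (iter (Suc (Suc n))) (chain (Suc n) x) (chain (Suc n) y) = dst (iter (Suc n)) x y"
    if "x \<in> carrier (iter (Suc n))" "y \<in> carrier (iter (Suc n))" for x y
    using that tensor_dst_rep_map[OF p _ _ I(5) d]
    by (auto elim!: iter_SucE simp: c dst_iter_elem q simp del: iter.simps chain.simps)
  ultimately show ?case by (auto simp: isometric_embedding_def simp del: iter.simps chain.simps)
qed


section \<open>The colimit\<close>

declare iter.simps(2) [simp del] chain.simps(2) [simp del]

lemmas chain_isometricD =
  isometric_embedding_chain[unfolded isometric_embedding_def preserves_points_def Pi_iff]

lemma chain_in: "\<xi> \<in> carrier (iter n) \<Longrightarrow> chain n \<xi> \<in> carrier (iter (Suc n))"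
  using chain_isometricD by blast

primrec lift :: "nat \<Rightarrow> nat \<Rightarrow> word_class \<Rightarrow> word_class" where
  "lift n 0 \<xi> = \<xi>"
| "lift n (Suc k) \<xi> = chain (n + k) (lift n k \<xi>)"

lemma lift_in: "\<xi> \<in> carrier (iter n) \<Longrightarrow> lift n k \<xi> \<in> carrier (iter (n + k))"
  by (induction k) (simp_all add: chain_in)

lemma lift_lift: "lift (n + k) l (lift n k \<xi>) = lift n (k + l) \<xi>"
  by (induction l) (simp_all add: add.assoc)

lemma dst_lift:
  assumes "\<xi> \<in> carrier (iter n)" "\<eta> \<in> carrier (iter n)"
  shows "dst (iter (n + k)) (lift n k \<xi>) (lift n k \<eta>) = dst (iter n) \<xi> \<eta>"
  using assms chain_isometricD by (induction k) (simp_all add: lift_in)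

text \<open>Stages \<open>n\<close> and \<open>m\<close> are compared at stage \<open>n + m\<close>
  instead of their maximum, which avoids a case distinction on their order. By
  \<open>colim_dst_eq\<close> every common stage gives the same value.\<close>

fun colim_dst :: "nat \<times> word_class \<Rightarrow> nat \<times> word_class \<Rightarrow> real" where
  "colim_dst (n, \<xi>) (m, \<eta>) = dst (iter (n + m)) (lift n m \<xi>) (lift m n \<eta>)"

declare colim_dst.simps [simp del]

text \<open>Both sides are pushed to stage \<open>n + m + p\<close>, where the lifts coincide;
  lifting is isometric.\<close>

lemma colim_dst_eq:
  assumes \<xi>: "\<xi> \<in> carrier (iter n)" and \<eta>: "\<eta> \<in> carrier (iter m)" and p: "n + k = p" "m + l = p"
  shows "colim_dst (n, \<xi>) (m, \<eta>) = dst (iter p) (lift n k \<xi>) (lift m l \<eta>)"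
proof -
  have "lift n m \<xi> \<in> carrier (iter (n + m))" "lift m n \<eta> \<in> carrier (iter (n + m))"
    "lift n k \<xi> \<in> carrier (iter p)" "lift m l \<eta> \<in> carrier (iter p)"
    using lift_in[OF \<xi>] lift_in[OF \<eta>] p by (metis add.commute)+
  moreover have "m + p = k + (n + m)" "n + p = l + (n + m)"
    using p by simp_all
  then have "lift (n + m) p (lift n m \<xi>) = lift p (n + m) (lift n k \<xi>)"
    "lift (n + m) p (lift m n \<eta>) = lift p (n + m) (lift m l \<eta>)"
    using lift_lift[of n m p \<xi>] lift_lift[of n k "n + m" \<xi>] lift_lift[of m n p \<eta>]
      lift_lift[of m l "n + m" \<eta>] p by (metis add.commute)+
  ultimately show ?thesis
    using dst_lift[of "lift n m \<xi>" "n + m" "lift m n \<eta>" p]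
      dst_lift[of "lift n k \<xi>" p "lift m l \<eta>" "n + m"]
    by (simp add: add.commute colim_dst.simps)
qed

definition colim_gen :: "(nat \<times> word_class) rel" where
  "colim_gen = {((n, \<xi>), (Suc n, chain n \<xi>)) | n \<xi>. \<xi> \<in> carrier (iter n)}"

lemma lift_colim_gen:
  assumes "\<xi> \<in> carrier (iter n)"
  shows "((n, \<xi>), (n + k, lift n k \<xi>)) \<in> (colim_gen \<union> colim_gen\<inverse>)\<^sup>*"
proof (induction k)
  case (Suc k)
  have "((n + k, lift n k \<xi>), (n + Suc k, lift n (Suc k) \<xi>)) \<in> colim_gen \<union> colim_gen\<inverse>"
    using lift_in[OF assms] by (auto simp: colim_gen_def)
  with Suc show ?case by (rule rtrancl_into_rtrancl)
qed simp

text \<open>The triangle inequality is read off at a stage common to all three points. For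
  \<open>D_sep\<close>, distance 0 forces equal lifts, because every stage is a metric space, and
  each representative is joined to its lift by chain steps.\<close>

lemma pseudometric_quotient_colim: "pseudometric_quotient stages colim_gen colim_dst"
proof
  note M = tripointed_metricD[OF tripointed_metric_iter]
  show "colim_gen \<subseteq> stages \<times> stages"
    using chain_in by (auto simp: colim_gen_def stages_def)
  show "colim_dst p q = 0" if pq: "(p, q) \<in> colim_gen" for p q
  proof -
    obtain n \<xi> where \<xi>: "p = (n, \<xi>)" "q = (Suc n, chain n \<xi>)" "\<xi> \<in> carrier (iter n)"
      using pq by (auto simp: colim_gen_def)
    then show ?thesis
      using colim_dst_eq[OF \<xi>(3) chain_in[OF \<xi>(3)], of 1 "Suc n" 0] M(17)[OF chain_in[OF \<xi>(3)]] by simp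
  qed
  fix p q assume "p \<in> stages" "q \<in> stages"
  then obtain n \<xi> m \<eta> where p: "p = (n, \<xi>)" and q: "q = (m, \<eta>)"
    and \<xi>: "\<xi> \<in> carrier (iter n)" and \<eta>: "\<eta> \<in> carrier (iter m)"
    by (auto simp: stages_def)
  show "colim_dst p p = 0"
    using M(17)[OF \<xi>] colim_dst_eq[OF \<xi> \<xi>, of 0 n 0] p by simp
  show "0 \<le> colim_dst p q"
    using M(13) p q by (simp add: colim_dst.simps)
  show "colim_dst p q = colim_dst q p"
    using M(14) p q by (simp add: colim_dst.simps add.commute)
  show "colim_dst p s \<le> colim_dst p q + colim_dst q s" if S: "s \<in> stages" for s
  proof -
    obtain l \<zeta> where s: "s = (l, \<zeta>)" and \<zeta>: "\<zeta> \<in> carrier (iter l)"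
      using S by (auto simp: stages_def)
    let ?N = "n + m + l"
    have e: "n + (m + l) = ?N" "m + (n + l) = ?N" "l + (n + m) = ?N" by simp_all
    note L = lift_in[OF \<xi>, of "m + l", unfolded e] lift_in[OF \<eta>, of "n + l", unfolded e]
      lift_in[OF \<zeta>, of "n + m", unfolded e]
    show ?thesis
      unfolding p q s colim_dst_eq[OF \<xi> \<eta> e(1,2)] colim_dst_eq[OF \<xi> \<zeta> e(1,3)] colim_dst_eq[OF \<eta> \<zeta> e(2,3)]
      by (rule M(16)[OF L])
  qed
  show "(p, q) \<in> (colim_gen \<union> colim_gen\<inverse>)\<^sup>*" if z: "colim_dst p q = 0"
  proof -
    have "lift n m \<xi> = lift m n \<eta>"
      using z M(15)[OF lift_in[OF \<xi>]] lift_in[OF \<eta>, of n] p q by (simp add: colim_dst.simps add.commute)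
    then have "(p, (n + m, lift n m \<xi>)) \<in> (colim_gen \<union> colim_gen\<inverse>)\<^sup>*"
      and "(q, (n + m, lift n m \<xi>)) \<in> (colim_gen \<union> colim_gen\<inverse>)\<^sup>*"
      using lift_colim_gen[OF \<xi>, of m] lift_colim_gen[OF \<eta>, of n] p q by (simp_all add: add.commute)
    moreover have "sym ((colim_gen \<union> colim_gen\<inverse>)\<^sup>*)"
      by (intro sym_rtrancl sym_Un_converse)
    ultimately show ?thesis by (meson rtrancl_trans symD)
  qed
qed

lemma colim_rel_eq: "colim_rel = generated_equiv stages colim_gen"
  by (simp add: colim_rel_def colim_gen_def)

lemma stages_iff [simp]: "(n, \<xi>) \<in> stages \<longleftrightarrow> \<xi> \<in> carrier (iter n)"
  by (simp add: stages_def)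

lemma carrier_G: "carrier G = stages // colim_rel"
  by (simp add: G_def)

lemma colim_class_in: "\<xi> \<in> carrier (iter n) \<Longrightarrow> colim_class n \<xi> \<in> carrier G"
  by (simp add: carrier_G colim_class_def quotientI)

lemma carrier_GE:
  assumes "P \<in> carrier G"
  obtains n \<xi> where "\<xi> \<in> carrier (iter n)" "P = colim_class n \<xi>"
  using assms by (auto simp: carrier_G colim_class_def elim!: quotientE)

lemma colim_class_eq_iff:
  assumes "\<xi> \<in> carrier (iter n)" "\<eta> \<in> carrier (iter m)"
  shows "colim_class n \<xi> = colim_class m \<eta> \<longleftrightarrow> colim_dst (n, \<xi>) (m, \<eta>) = 0"
  using pseudometric_quotient.class_eq_iff[OF pseudometric_quotient_colim] assms
  by (simp add: colim_class_def colim_rel_eq)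

lemma mem_colim_classD:
  assumes "(n, \<xi>) \<in> P" "P \<in> carrier G"
  shows "\<xi> \<in> carrier (iter n)" "P = colim_class n \<xi>"
proof -
  have P: "P \<in> stages // colim_rel" using assms(2) by (simp add: carrier_G)
  then have "P \<subseteq> stages" by (auto simp: quotient_def colim_rel_eq generated_equiv_def)
  then show "\<xi> \<in> carrier (iter n)" using assms(1) by auto
  obtain q where "P = colim_rel `` {q}" using P by (rule quotientE)
  then show "P = colim_class n \<xi>"
    using equiv_class_eq[OF equiv_generated_equiv, of q "(n, \<xi>)"] assms(1)
    by (simp add: colim_class_def colim_rel_eq)
qed

lemma mem_colim_class: "\<xi> \<in> carrier (iter n) \<Longrightarrow> (n, \<xi>) \<in> colim_class n \<xi>"
  using equiv_class_self[OF equiv_generated_equiv, of "(n, \<xi>)" stages colim_gen] by (simp add: colim_class_def colim_rel_eq)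

lemma colim_class_chain:
  assumes "\<xi> \<in> carrier (iter n)"
  shows "colim_class (Suc n) (chain n \<xi>) = colim_class n \<xi>"
proof -
  have "((n, \<xi>), (Suc n, chain n \<xi>)) \<in> colim_gen" using assms by (auto simp: colim_gen_def)
  then have "colim_dst (n, \<xi>) (Suc n, chain n \<xi>) = 0"
    using pseudometric_quotient.D_gen[OF pseudometric_quotient_colim] by blast
  then show ?thesis using colim_class_eq_iff[OF assms chain_in[OF assms]] by simp
qed

lemma colim_class_lift:
  "\<xi> \<in> carrier (iter n) \<Longrightarrow> colim_class (n + k) (lift n k \<xi>) = colim_class n \<xi>"
  by (induction k) (simp_all add: colim_class_chain lift_in)

lemma common_stage:
  assumes "P \<in> carrier G" "Q \<in> carrier G"
  obtains p \<xi> \<eta> where "\<xi> \<in> carrier (iter p)" "\<eta> \<in> carrier (iter p)"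
    "P = colim_class p \<xi>" "Q = colim_class p \<eta>"
proof -
  obtain n \<xi> m \<eta> where "\<xi> \<in> carrier (iter n)" "P = colim_class n \<xi>" "\<eta> \<in> carrier (iter m)" "Q = colim_class m \<eta>"
    using assms by (meson carrier_GE)
  then show ?thesis
    using that[of "lift n m \<xi>" "n + m" "lift m n \<eta>"] lift_in[of \<xi> n m] lift_in[of \<eta> m n]
      colim_class_lift[of \<xi> n m] colim_class_lift[of \<eta> m n]
    by (simp add: add.commute)
qed

lemma dst_G_colim_dst:
  assumes \<xi>: "\<xi> \<in> carrier (iter n)" and \<eta>: "\<eta> \<in> carrier (iter m)"
  shows "dst G (colim_class n \<xi>) (colim_class m \<eta>) = colim_dst (n, \<xi>) (m, \<eta>)"
proof -
  have "(THE r. \<exists>p \<xi>' \<eta>'. (p, \<xi>') \<in> colim_class n \<xi> \<and> (p, \<eta>') \<in> colim_class m \<eta> \<and> r = dst (iter p) \<xi>' \<eta>')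
      = colim_dst (n, \<xi>) (m, \<eta>)"
  proof (rule the_equality)
    have "(n + m, lift n m \<xi>) \<in> colim_class n \<xi>" "(n + m, lift m n \<eta>) \<in> colim_class m \<eta>"
      using mem_colim_class[OF lift_in[OF \<xi>]] mem_colim_class[OF lift_in[OF \<eta>]]
        colim_class_lift[OF \<xi>] colim_class_lift[OF \<eta>] by (metis add.commute)+
    then show "\<exists>p \<xi>' \<eta>'. (p, \<xi>') \<in> colim_class n \<xi> \<and> (p, \<eta>') \<in> colim_class m \<eta> \<and>
        colim_dst (n, \<xi>) (m, \<eta>) = dst (iter p) \<xi>' \<eta>'"
      by (auto simp: colim_dst.simps)
    fix r assume "\<exists>p \<xi>' \<eta>'. (p, \<xi>') \<in> colim_class n \<xi> \<and> (p, \<eta>') \<in> colim_class m \<eta> \<and> r = dst (iter p) \<xi>' \<eta>'"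
    then obtain p \<xi>' \<eta>' where *: "(p, \<xi>') \<in> colim_class n \<xi>" "(p, \<eta>') \<in> colim_class m \<eta>"
      "r = dst (iter p) \<xi>' \<eta>'" by auto
    have "colim_dst (p, \<xi>') (p, \<eta>') = colim_dst (n, \<xi>) (m, \<eta>)"
      using * by (intro pseudometric_quotient.D_cong[OF pseudometric_quotient_colim])
        (simp_all add: colim_class_def colim_rel_eq)
    moreover have "colim_dst (p, \<xi>') (p, \<eta>') = r"
      using colim_dst_eq[of \<xi>' p \<eta>' p 0 p 0] mem_colim_classD(1)[OF *(1) colim_class_in[OF \<xi>]]
        mem_colim_classD(1)[OF *(2) colim_class_in[OF \<eta>]] *(3) by simp
    ultimately show "r = colim_dst (n, \<xi>) (m, \<eta>)" by simp
  qed
  then show ?thesis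
    using colim_class_in[OF \<xi>] colim_class_in[OF \<eta>] unfolding carrier_G by (simp add: G_def)
qed

lemma dst_colim_class:
  assumes "\<xi> \<in> carrier (iter n)" "\<eta> \<in> carrier (iter n)"
  shows "dst G (colim_class n \<xi>) (colim_class n \<eta>) = dst (iter n) \<xi> \<eta>"
  using dst_G_colim_dst[OF assms] colim_dst_eq[OF assms, of 0 n 0] by simp

lemma colim_class_points:
  "colim_class n (Tpt (iter n)) = Tpt G" "colim_class n (Lpt (iter n)) = Lpt G"
  "colim_class n (Rpt (iter n)) = Rpt G"
proof (induction n)
  case (Suc n)
  note M = tripointed_metricD[OF tripointed_metric_iter]
  { case 1 then show ?case using colim_class_chain[OF M(1), of n] chain_isometricD Suc by metis }
  { case 2 then show ?case using colim_class_chain[OF M(2), of n] chain_isometricD Suc by metis }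
  { case 3 then show ?case using colim_class_chain[OF M(3), of n] chain_isometricD Suc by metis }
qed (simp_all add: G_def)

lemma isometric_embedding_colim_class: "isometric_embedding (iter n) G (colim_class n)"
  by (simp add: isometric_embedding_def preserves_points_def colim_class_points dst_colim_class colim_class_in)

lemma tripointed_metric_G: "tripointed_metric G"
proof -
  note M = tripointed_metricD[OF tripointed_metric_iter]
  have "Metric_space (carrier G) (dst G)"
    unfolding carrier_G colim_rel_eq
  proof (rule pseudometric_quotient.metric_quotient[OF pseudometric_quotient_colim], goal_cases)
    case (1 p q)
    then show ?case using dst_G_colim_dst by (auto simp: colim_class_def colim_rel_eq stages_def)
  next
    case (2 P Q)
    then show ?case by (auto simp: G_def colim_rel_eq)
  qed
  moreover have "dst G P Q \<le> 1" if "P \<in> carrier G" "Q \<in> carrier G" for P Q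
    using common_stage[OF that] M(6) by (metis dst_colim_class)
  moreover have "Tpt G \<in> carrier G" "Lpt G \<in> carrier G" "Rpt G \<in> carrier G"
    using colim_class_in[OF M(1)] colim_class_in[OF M(2)] colim_class_in[OF M(3)] colim_class_points
    by metis+
  moreover have "dst G (Tpt G) (Lpt G) = 1" "dst G (Tpt G) (Rpt G) = 1" "dst G (Lpt G) (Rpt G) = 1"
    using M(7-9)[of 0] M(1-3)[of 0] by (simp_all add: dst_colim_class flip: colim_class_points[of 0])
  ultimately show ?thesis
    unfolding tripointed_metric_def tripointed_def by blast
qed


section \<open>The structure map\<close>

text \<open>Tensoring with a fixed cell commutes with the chain maps, so
  \<open>[m \<otimes> \<xi>]\<close> does not depend on the stage at which \<open>[\<xi>]\<close> is
  represented.\<close>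

lemma colim_class_iter_elem_lift:
  assumes "\<xi> \<in> carrier (iter n)"
  shows "colim_class (Suc (n + k)) (iter_elem (n + k) m (lift n k \<xi>)) = colim_class (Suc n) (iter_elem n m \<xi>)"
proof (induction k)
  case (Suc k)
  have l: "lift n k \<xi> \<in> carrier (iter (n + k))" by (rule lift_in[OF assms])
  have "chain (Suc (n + k)) (iter_elem (n + k) m (lift n k \<xi>))
      = iter_elem (Suc (n + k)) m (chain (n + k) (lift n k \<xi>))"
    using isometric_embedding_chain l by (intro chain_Suc) (auto simp: isometric_embedding_def)
  then show ?case using colim_class_chain[OF iter_elem_in[OF l], of m] Suc
    by (metis add_Suc_right lift.simps(2))
qed simp

text \<open>Used twice: at distance 0 it shows that \<open>g\<close> is well defined, and in general
  that \<open>g\<close> is isometric. After lifting to stage \<open>n + l\<close>, the formula for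
  the next iterate applies and \<open>colim_class\<close> preserves its ingredients.\<close>

lemma dst_colim_class_iter_elem:
  assumes \<xi>: "\<xi> \<in> carrier (iter n)" and \<eta>: "\<eta> \<in> carrier (iter l)"
  shows "dst G (colim_class (Suc n) (iter_elem n m \<xi>)) (colim_class (Suc l) (iter_elem l k \<eta>))
    = tensor_dst_rep G (m, colim_class n \<xi>) (k, colim_class l \<eta>)"
proof -
  let ?N = "n + l" and ?\<xi> = "lift n l \<xi>" and ?\<eta> = "lift l n \<eta>"
  have c: "?\<xi> \<in> carrier (iter ?N)" "?\<eta> \<in> carrier (iter ?N)"
    using lift_in[OF \<xi>] lift_in[OF \<eta>] by (metis add.commute)+
  have e: "colim_class (Suc n) (iter_elem n m \<xi>) = colim_class (Suc ?N) (iter_elem ?N m ?\<xi>)"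
    "colim_class (Suc l) (iter_elem l k \<eta>) = colim_class (Suc ?N) (iter_elem ?N k ?\<eta>)"
    "colim_class n \<xi> = colim_class ?N ?\<xi>" "colim_class l \<eta> = colim_class ?N ?\<eta>"
    using colim_class_iter_elem_lift[OF \<xi>] colim_class_iter_elem_lift[OF \<eta>]
      colim_class_lift[OF \<xi>] colim_class_lift[OF \<eta>] by (metis add.commute)+
  have "tensor_dst_rep G (m, colim_class ?N ?\<xi>) (k, colim_class ?N ?\<eta>)
      = tensor_dst_rep (iter ?N) (m, ?\<xi>) (k, ?\<eta>)"
    using isometric_embedding_colim_class[of ?N] c tripointed_metricD(5)[OF tripointed_metric_iter]
    by (intro tensor_dst_rep_map) (auto simp: isometric_embedding_def)
  then show ?thesis
    unfolding e using c by (simp add: dst_colim_class iter_elem_in dst_iter_elem)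
qed

text \<open>Members of one tensor class are at distance 0, so the classes assigned to them are at
  distance 0 in the metric space \<open>G\<close> and coincide.\<close>

lemma g_elem:
  assumes \<xi>: "\<xi> \<in> carrier (iter n)"
  shows "g (tensor_elem G m (colim_class n \<xi>)) = colim_class (Suc n) (iter_elem n m \<xi>)"
proof -
  let ?C = "tensor_elem G m (colim_class n \<xi>)" and ?R = "colim_class (Suc n) (iter_elem n m \<xi>)"
  note P = colim_class_in[OF \<xi>]
  note M = tripointed_metricD[OF tripointed_metric_G]
  have const: "colim_class (Suc l) (iter_elem l k \<eta>) = ?R" if Q: "(k, Q) \<in> ?C" "(l, \<eta>) \<in> Q" for k Q l \<eta>
  proof -
    have "((m, colim_class n \<xi>), (k, Q)) \<in> tensor_rel G" using Q by (simp add: mem_tensor_elem_iff)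
    then have z: "tensor_dst_rep G (m, colim_class n \<xi>) (k, Q) = 0" and "Q \<in> carrier G"
      using pseudometric_quotient.rel_iff[OF pseudometric_quotient_tensor[OF tripointed_metric_G]]
      by (auto simp: tensor_rel_eq)
    then have \<eta>: "\<eta> \<in> carrier (iter l)" "Q = colim_class l \<eta>" using Q mem_colim_classD by blast+
    then have "dst G ?R (colim_class (Suc l) (iter_elem l k \<eta>)) = 0"
      using z dst_colim_class_iter_elem[OF \<xi>] by simp
    then show ?thesis
      using M(15) \<xi> \<eta> by (simp add: colim_class_in iter_elem_in)
  qed
  have "g ?C = (\<Union>(k, Q)\<in>?C. \<Union>(l, \<eta>)\<in>Q. colim_class (Suc l) (iter_elem l k \<eta>))"
    using tensor_elem_in[OF P, of m] by (simp add: g_def)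
  also have "\<dots> = ?R"
  proof (intro equalityI)
    show "(\<Union>(k, Q)\<in>?C. \<Union>(l, \<eta>)\<in>Q. colim_class (Suc l) (iter_elem l k \<eta>)) \<subseteq> ?R"
      using const by fastforce
    show "?R \<subseteq> (\<Union>(k, Q)\<in>?C. \<Union>(l, \<eta>)\<in>Q. colim_class (Suc l) (iter_elem l k \<eta>))"
      using tensor_elem_self[OF P, of m] mem_colim_class[OF \<xi>] by fast
  qed
  finally show ?thesis .
qed

lemma g_in:
  assumes "C \<in> (UNIV \<times> carrier G) // tensor_rel G"
  shows "g C \<in> carrier G"
  using assms by (auto elim!: tensor_carrierE carrier_GE simp: g_elem intro!: colim_class_in iter_elem_in)

lemma g_points:
  "g (tensor_elem G Ca (Tpt G)) = Tpt G" "g (tensor_elem G Cb (Lpt G)) = Lpt G"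
  "g (tensor_elem G Cc (Rpt G)) = Rpt G"
  using g_elem[OF tripointed_metricD(1)[OF tripointed_metric_iter], of Ca 0]
    g_elem[OF tripointed_metricD(2)[OF tripointed_metric_iter], of Cb 0]
    g_elem[OF tripointed_metricD(3)[OF tripointed_metric_iter], of Cc 0]
  unfolding iter_Suc_points[symmetric] colim_class_points by simp_all

lemma g_hom: "g \<in> set_hom (tensor_met G) G" "g \<in> set_hom (tensor G) G"
  using g_in g_points by (auto simp: set_hom_def g_def restrict_def)

lemma dst_g:
  assumes "P \<in> carrier G" "Q \<in> carrier G"
  shows "dst G (g (tensor_elem G m P)) (g (tensor_elem G k Q)) = tensor_dst_rep G (m, P) (k, Q)"
proof -
  obtain p \<xi> \<eta> where "\<xi> \<in> carrier (iter p)" "\<eta> \<in> carrier (iter p)" "P = colim_class p \<xi>" "Q = colim_class p \<eta>"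
    using common_stage[OF assms] .
  then show ?thesis using dst_colim_class_iter_elem by (simp add: g_elem)
qed

lemma g_surj:
  assumes "P \<in> carrier G"
  shows "P \<in> g ` ((UNIV \<times> carrier G) // tensor_rel G)"
proof -
  obtain n \<xi> where "\<xi> \<in> carrier (iter n)" "P = colim_class n \<xi>" using assms by (rule carrier_GE)
  \<comment> \<open>One chain step puts even the three points of stage 0 at a positive stage, where
    every element has the form \<open>m \<otimes> \<eta>\<close>.\<close>
  then have "chain n \<xi> \<in> carrier (iter (Suc n))" "P = colim_class (Suc n) (chain n \<xi>)"
    by (simp_all add: chain_in colim_class_chain)
  then obtain m \<eta> where \<eta>: "\<eta> \<in> carrier (iter n)" "P = colim_class (Suc n) (iter_elem n m \<eta>)"
    by (metis iter_SucE)
  then have "P = g (tensor_elem G m (colim_class n \<eta>))" by (simp add: g_elem)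
  then show ?thesis using tensor_elem_in[OF colim_class_in[OF \<eta>(1)]] by blast
qed

lemma isometric_iso_g: "isometric_iso (tensor_met G) G g"
proof -
  have d: "dst G (g C) (g D) = tensor_dst G C D"
    if "C \<in> (UNIV \<times> carrier G) // tensor_rel G" "D \<in> (UNIV \<times> carrier G) // tensor_rel G" for C D
    using that by (auto elim!: tensor_carrierE simp: dst_g tensor_dst_elem[OF tripointed_metric_G])
  note M = tripointed_metricD[OF tripointed_metric_G]
  note N = tripointed_metricD[OF tripointed_metric_tensor[OF tripointed_metric_G], simplified]
  have "inj_on g ((UNIV \<times> carrier G) // tensor_rel G)"
  proof (rule inj_onI)
    fix C D assume CD: "C \<in> (UNIV \<times> carrier G) // tensor_rel G" "D \<in> (UNIV \<times> carrier G) // tensor_rel G"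
      and "g C = g D"
    then have "tensor_dst G C D = 0" using d[OF CD] M(17)[OF g_in] by simp
    then show "C = D" using N(15) CD by simp
  qed
  then show ?thesis
    using g_hom d g_surj g_in by (auto simp: isometric_iso_def bij_betw_def)
qed


section \<open>Initiality among tri-pointed sets\<close>

text \<open>Evaluates a word in the algebra \<open>Y\<close>, one letter per application of
  \<open>e\<close>. A word class has no preferred first letter, so \<open>SOME\<close> picks one
  decomposition; \<open>stage_map_iter_elem\<close> shows that any other gives the same
  value.\<close>

primrec stage_map :: "('b, 'z) tri_scheme \<Rightarrow> ((cell \<times> 'b) set \<Rightarrow> 'b) \<Rightarrow> nat \<Rightarrow> word_class \<Rightarrow> 'b" where
  "stage_map Y e 0 = (\<lambda>\<xi>. if \<xi> = Tpt I3 then Tpt Y else if \<xi> = Lpt I3 then Lpt Y else Rpt Y)"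
| "stage_map Y e (Suc n) = (\<lambda>\<zeta>.
     let (m, \<xi>) = SOME (m, \<xi>). \<xi> \<in> carrier (iter n) \<and> \<zeta> = iter_elem n m \<xi>
     in e (tensor_elem Y m (stage_map Y e n \<xi>)))"

lemma set_algD:
  assumes "set_alg Y e"
  shows "y \<in> carrier Y \<Longrightarrow> e (tensor_elem Y m y) \<in> carrier Y"
    and "e (tensor_elem Y Ca (Tpt Y)) = Tpt Y" "e (tensor_elem Y Cb (Lpt Y)) = Lpt Y"
    "e (tensor_elem Y Cc (Rpt Y)) = Rpt Y"
    and "Tpt Y \<in> carrier Y" "Lpt Y \<in> carrier Y" "Rpt Y \<in> carrier Y"
  using assms tensor_elem_in[of y Y m] by (auto simp: set_alg_def tripointed_def set_hom_def)

text \<open>Two decompositions of one element are related by the gluing in \<open>iter n\<close>. A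
  point-preserving map carries this to the gluing in \<open>Y\<close>, so \<open>e\<close> receives
  the same class.\<close>

lemma stage_map_iter_elem:
  assumes f: "preserves_points (iter n) Y (stage_map Y e n)" and \<xi>: "\<xi> \<in> carrier (iter n)"
  shows "stage_map Y e (Suc n) (iter_elem n m \<xi>) = e (tensor_elem Y m (stage_map Y e n \<xi>))"
proof -
  let ?P = "\<lambda>(k, \<eta>). \<eta> \<in> carrier (iter n) \<and> iter_elem n m \<xi> = iter_elem n k \<eta>"
  obtain k \<eta> where k: "(SOME p. ?P p) = (k, \<eta>)" by (cases "SOME p. ?P p")
  have "?P (SOME p. ?P p)" by (rule someI[where x = "(m, \<xi>)"]) (simp add: \<xi>)
  then have \<eta>: "\<eta> \<in> carrier (iter n)" "iter_elem n m \<xi> = iter_elem n k \<eta>"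
    unfolding k by simp_all
  then have rel: "((m, stage_map Y e n \<xi>), (k, stage_map Y e n \<eta>)) \<in> tensor_rel Y"
    using tensor_rel_map[OF f] \<xi> by (simp add: iter_elem_eq_iff)
  then have "tensor_elem Y m (stage_map Y e n \<xi>) = tensor_elem Y k (stage_map Y e n \<eta>)"
    using tensor_rel_carrier[OF rel] by (simp add: tensor_elem_eq_iff)
  then show ?thesis unfolding stage_map.simps(2) k by simp
qed

lemma stage_map_preserves_points:
  assumes Y: "set_alg Y e"
  shows "preserves_points (iter n) Y (stage_map Y e n)"
proof (induction n)
  case 0
  have "Tpt I3 \<noteq> Lpt I3" "Tpt I3 \<noteq> Rpt I3" "Lpt I3 \<noteq> Rpt I3" by (auto simp: I3_def)
  then show ?case using set_algD(5-7)[OF Y] by (auto simp: preserves_points_def)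
next
  case (Suc n)
  note r = stage_map_iter_elem[OF Suc] and M = tripointed_metricD(1-3)[OF tripointed_metric_iter]
  have "stage_map Y e n \<xi> \<in> carrier Y" if "\<xi> \<in> carrier (iter n)" for \<xi>
    using Suc that by (auto simp: preserves_points_def)
  then have "stage_map Y e (Suc n) \<zeta> \<in> carrier Y" if "\<zeta> \<in> carrier (iter (Suc n))" for \<zeta>
    using that set_algD(1)[OF Y] by (elim iter_SucE) (simp add: r del: stage_map.simps)
  then show ?case
    using Suc set_algD(2-4)[OF Y] unfolding preserves_points_def iter_Suc_points
    by (simp add: r M del: stage_map.simps)
qed

text \<open>Compatibility with the chain lets the stage maps descend to the colimit. On stage 0 both
  sides are fixed by preservation of the distinguished points; afterwards both satisfy the same
  recursion.\<close>

lemma stage_map_chain: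
  assumes Y: "set_alg Y e" and "\<xi> \<in> carrier (iter n)"
  shows "stage_map Y e (Suc n) (chain n \<xi>) = stage_map Y e n \<xi>"
  using assms(2)
proof (induction n arbitrary: \<xi>)
  case 0
  then have "\<xi> \<in> {Tpt (iter 0), Lpt (iter 0), Rpt (iter 0)}" by (simp add: carrier_I3)
  then show ?case
    using stage_map_preserves_points[OF Y, of 0] stage_map_preserves_points[OF Y, of "Suc 0"]
      chain_isometricD[of 0]
    unfolding preserves_points_def by (metis insertE singletonD)
next
  case (Suc n)
  obtain m \<eta> where \<eta>: "\<eta> \<in> carrier (iter n)" "\<xi> = iter_elem n m \<eta>"
    using Suc.prems by (rule iter_SucE)
  have "chain (Suc n) \<xi> = iter_elem (Suc n) m (chain n \<eta>)"
    using isometric_embedding_chain \<eta> by (simp add: chain_Suc isometric_embedding_def)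
  then show ?case
    using \<eta> Suc.IH[OF \<eta>(1)] stage_map_preserves_points[OF Y]
    by (simp add: stage_map_iter_elem chain_in del: stage_map.simps)
qed

lemma stage_map_lift:
  assumes "set_alg Y e" "\<xi> \<in> carrier (iter n)"
  shows "stage_map Y e (n + k) (lift n k \<xi>) = stage_map Y e n \<xi>"
  using assms by (induction k) (simp_all add: stage_map_chain lift_in del: stage_map.simps)

lemma stage_map_cong:
  assumes Y: "set_alg Y e" and c: "\<xi> \<in> carrier (iter n)" "\<eta> \<in> carrier (iter m)"
    and eq: "colim_class n \<xi> = colim_class m \<eta>"
  shows "stage_map Y e n \<xi> = stage_map Y e m \<eta>"
proof -
  have "dst (iter (n + m)) (lift n m \<xi>) (lift m n \<eta>) = 0"
    using eq c by (simp add: colim_class_eq_iff colim_dst.simps)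
  then have "lift n m \<xi> = lift m n \<eta>"
    using tripointed_metricD(15)[OF tripointed_metric_iter lift_in[OF c(1)]] lift_in[OF c(2), of n]
    by (simp add: add.commute)
  then show ?thesis
    using stage_map_lift[OF Y c(1), of m] stage_map_lift[OF Y c(2), of n] by (simp add: add.commute)
qed

definition colim_map :: "('b, 'z) tri_scheme \<Rightarrow> ((cell \<times> 'b) set \<Rightarrow> 'b) \<Rightarrow> gpoint \<Rightarrow> 'b" where
  "colim_map Y e = (\<lambda>P\<in>carrier G. let (n, \<xi>) = SOME p. p \<in> P in stage_map Y e n \<xi>)"

lemma colim_map_class:
  assumes Y: "set_alg Y e" and \<xi>: "\<xi> \<in> carrier (iter n)"
  shows "colim_map Y e (colim_class n \<xi>) = stage_map Y e n \<xi>"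
proof -
  obtain m \<eta> where m: "(SOME p. p \<in> colim_class n \<xi>) = (m, \<eta>)" by (metis surj_pair)
  then have "(m, \<eta>) \<in> colim_class n \<xi>" using mem_colim_class[OF \<xi>] by (metis someI_ex)
  then have "\<eta> \<in> carrier (iter m)" "colim_class n \<xi> = colim_class m \<eta>"
    using mem_colim_classD colim_class_in[OF \<xi>] by blast+
  then have "stage_map Y e m \<eta> = stage_map Y e n \<xi>" using stage_map_cong[OF Y \<xi>] by simp
  then show ?thesis using m colim_class_in[OF \<xi>] by (simp add: colim_map_def)
qed

lemma colim_map_hom:
  assumes Y: "set_alg Y e"
  shows "colim_map Y e \<in> alg_hom (set_hom G Y) G g Y e"
proof -
  note p = stage_map_preserves_points[OF Y]
  have "colim_map Y e P \<in> carrier Y" if "P \<in> carrier G" for P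
    using that p by (auto elim!: carrier_GE simp: colim_map_class[OF Y] preserves_points_def Pi_iff)
  moreover have "colim_map Y e (Tpt G) = Tpt Y" "colim_map Y e (Lpt G) = Lpt Y" "colim_map Y e (Rpt G) = Rpt Y"
    using colim_map_class[OF Y tripointed_metricD(1)[OF tripointed_metric_iter[of 0]]]
      colim_map_class[OF Y tripointed_metricD(2)[OF tripointed_metric_iter[of 0]]]
      colim_map_class[OF Y tripointed_metricD(3)[OF tripointed_metric_iter[of 0]]] p[of 0]
    unfolding colim_class_points preserves_points_def by simp_all
  ultimately have h: "preserves_points G Y (colim_map Y e)" by (simp add: preserves_points_def)
  have "colim_map Y e (g C) = e (tensor_map G Y (colim_map Y e) C)"
    if C: "C \<in> (UNIV \<times> carrier G) // tensor_rel G" for C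
  proof -
    obtain m P where P: "P \<in> carrier G" "C = tensor_elem G m P" using C by (rule tensor_carrierE)
    then obtain n \<xi> where \<xi>: "\<xi> \<in> carrier (iter n)" "P = colim_class n \<xi>" by (meson carrier_GE)
    have "colim_map Y e (g C) = stage_map Y e (Suc n) (iter_elem n m \<xi>)"
      using P \<xi> colim_map_class[OF Y iter_elem_in[OF \<xi>(1)]] by (simp add: g_elem del: stage_map.simps)
    also have "\<dots> = e (tensor_elem Y m (colim_map Y e P))"
      using \<xi> by (simp add: stage_map_iter_elem p colim_map_class[OF Y] del: stage_map.simps)
    finally show ?thesis using tensor_map_elem[OF h P(1)] P by simp
  qed
  moreover have "colim_map Y e \<in> extensional (carrier G)" by (simp add: colim_map_def)
  ultimately show ?thesis using h by (simp add: alg_hom_def set_hom_iff)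
qed

text \<open>The values at the three points are prescribed, and the algebra equation forces the value
  at \<open>[m \<otimes> \<xi>]\<close> from the value at \<open>[\<xi>]\<close>; induction on the
  stage does the rest.\<close>

lemma alg_hom_unique:
  assumes f: "f \<in> alg_hom (set_hom G Y) G g Y e" and f': "f' \<in> alg_hom (set_hom G Y) G g Y e"
  shows "f = f'"
proof -
  have p: "preserves_points G Y f" "preserves_points G Y f'"
    using f f' by (simp_all add: alg_hom_def set_hom_iff)
  have step: "h (colim_class (Suc n) (iter_elem n m \<xi>)) = e (tensor_elem Y m (h (colim_class n \<xi>)))"
    if "h \<in> alg_hom (set_hom G Y) G g Y e" "\<xi> \<in> carrier (iter n)" for h n m \<xi>
    using that tensor_map_elem[OF _ colim_class_in[OF that(2)], of Y h m] tensor_elem_in[OF colim_class_in[OF that(2)], of m]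
    by (auto simp: alg_hom_def set_hom_iff g_elem)
  have "f (colim_class n \<xi>) = f' (colim_class n \<xi>)" if "\<xi> \<in> carrier (iter n)" for n \<xi>
    using that
  proof (induction n arbitrary: \<xi>)
    case 0
    then have "\<xi> \<in> {Tpt (iter 0), Lpt (iter 0), Rpt (iter 0)}" by (simp add: carrier_I3)
    then show ?case
      using p colim_class_points[of 0] unfolding preserves_points_def by (metis insertE singletonD)
  next
    case (Suc n)
    from Suc.prems show ?case
      by (rule iter_SucE) (simp add: step[OF f] step[OF f'] Suc.IH)
  qed
  then have "f P = f' P" if "P \<in> carrier G" for P
    using that by (metis carrier_GE)
  moreover have "f \<in> extensional (carrier G)" "f' \<in> extensional (carrier G)"
    using f f' by (simp_all add: alg_hom_def set_hom_iff)
  ultimately show ?thesis by (meson extensionalityI)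
qed

lemma set_initial_G: "set_initial G g TYPE('b)"
  unfolding set_initial_def set_alg_def[of G]
  using colim_map_hom alg_hom_unique g_hom(2) tripointed_metricD(5)[OF tripointed_metric_G] by blast


section \<open>A uniformly discrete algebra\<close>

definition discrete_G :: "gpoint tri_met" where
  "discrete_G = G\<lparr>dst := \<lambda>P Q. if P = Q then 0 else 1\<rparr>"

lemma discrete_G_simps [simp]:
  "carrier discrete_G = carrier G" "Tpt discrete_G = Tpt G" "Lpt discrete_G = Lpt G"
  "Rpt discrete_G = Rpt G" "dst discrete_G P Q = (if P = Q then 0 else 1)"
  by (simp_all add: discrete_G_def)

lemma tripointed_metric_discrete_G: "tripointed_metric discrete_G"
proof -
  note M = tripointed_metricD[OF tripointed_metric_G]
  have "Tpt G \<noteq> Lpt G" "Tpt G \<noteq> Rpt G" "Lpt G \<noteq> Rpt G"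
    using M(1-3,7-9,17) by force+
  moreover have "Metric_space (carrier discrete_G) (dst discrete_G)"
    by unfold_locales auto
  ultimately show ?thesis
    using M(1-3) by (simp add: tripointed_metric_def tripointed_def)
qed

text \<open>The gluing ignores the metric, which is why the same function \<open>g\<close> can serve
  as structure map of the discrete copy.\<close>

lemma tensor_discrete_G [simp]:
  "tensor_rel discrete_G = tensor_rel G" "tensor_elem discrete_G = tensor_elem G"
  by (simp_all add: tensor_rel_def tensor_elem_def fun_eq_iff)

lemma mspace_met_of: "tripointed_metric X \<Longrightarrow> mspace (met_of X) = carrier X"
  and mdist_met_of: "tripointed_metric X \<Longrightarrow> mdist (met_of X) = dst X"
  using Metric_space.mspace_metric Metric_space.mdist_metric tripointed_metricD(4)
  unfolding met_of_def by metis+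

text \<open>Distances 0 and 1 make every value of the formulas an integer multiple of 1/2, so there
  is a gap below 1/2.\<close>

lemma tensor_dst_rep_discrete_G:
  assumes "tensor_dst_rep discrete_G (m, P) (k, Q) < 1 / 2"
  shows "tensor_dst_rep discrete_G (m, P) (k, Q) = 0"
  using assms by (cases m; cases k) (auto simp: min_def split: if_splits)

lemma lip_alg_discrete_G: "lip_alg discrete_G g"
proof -
  note T = tripointed_metric_tensor[OF tripointed_metric_discrete_G]
  note N = tripointed_metricD[OF T, simplified]
  \<comment> \<open>The constant 2 is the largest distance in the target, 1, divided by the smallest
    positive distance in the source, 1/2.\<close>
  have "dst discrete_G (g C) (g D) \<le> 2 * tensor_dst discrete_G C D"
    if CD: "C \<in> (UNIV \<times> carrier G) // tensor_rel G" "D \<in> (UNIV \<times> carrier G) // tensor_rel G" for C D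
  proof (cases "tensor_dst discrete_G C D < 1 / 2")
    case True
    obtain m P k Q where "P \<in> carrier G" "Q \<in> carrier G" "C = tensor_elem G m P" "D = tensor_elem G k Q"
      using CD by (auto elim!: tensor_carrierE)
    then have "tensor_dst discrete_G C D = 0"
      using True tensor_dst_elem[OF tripointed_metric_discrete_G, of P Q m k] tensor_dst_rep_discrete_G
      by simp
    then have "C = D" using N(15)[OF CD] by simp
    then show ?thesis using N(13)[of C D] by simp
  qed simp
  then have "Lipschitz_continuous_map (met_of (tensor_met discrete_G)) (met_of discrete_G) g"
    using g_in unfolding Lipschitz_continuous_map_def mspace_met_of[OF T] mdist_met_of[OF T]
      mspace_met_of[OF tripointed_metric_discrete_G] mdist_met_of[OF tripointed_metric_discrete_G]
    by (auto simp del: discrete_G_simps(5) intro!: exI[of _ 2])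
  moreover have "g \<in> set_hom (tensor_met discrete_G) discrete_G"
    using g_hom(1) by (simp add: set_hom_def)
  ultimately show ?thesis
    by (simp add: lip_alg_def lip_hom_def tripointed_metric_discrete_G)
qed

lemma lip_hom_subset_cont_hom: "lip_hom X Y \<subseteq> cont_hom X Y"
  using Lipschitz_continuous_imp_continuous_map by (auto simp: lip_hom_def cont_hom_def)

lemma lip_alg_imp_cont_alg: "lip_alg X e \<Longrightarrow> cont_alg X e"
  using lip_hom_subset_cont_hom by (auto simp: lip_alg_def cont_alg_def)

section \<open>The only candidate morphism and its discontinuity\<close>

lemma identity_hom_discrete_G:
  "(\<lambda>P\<in>carrier G. P) \<in> alg_hom (set_hom G discrete_G) G g discrete_G g"
proof -
  note M = tripointed_metricD[OF tripointed_metric_G]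
  have p: "preserves_points G discrete_G (\<lambda>P\<in>carrier G. P)"
    using M(1-3) by (simp add: preserves_points_def)
  have "g C = g (tensor_map G discrete_G (\<lambda>P\<in>carrier G. P) C)"
    if "C \<in> (UNIV \<times> carrier G) // tensor_rel G" for C
    using that tensor_map_elem[OF p] by (auto elim!: tensor_carrierE)
  then show ?thesis using p g_in by (simp add: alg_hom_def set_hom_iff)
qed

text \<open>Prefixing the cell \<open>a\<close> fixes \<open>T\<close> and halves distances,
  starting from \<open>L\<close> at distance 1. The distance is stated exactly so that these points
  are visibly different from \<open>T\<close>.\<close>

lemma points_near_top:
  "\<exists>P\<in>carrier G. dst G (Tpt G) P = (1 / 2) ^ n"
proof (induction n)
  case 0
  show ?case using tripointed_metricD(2,7)[OF tripointed_metric_G] by auto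
next
  case (Suc n)
  then obtain P where P: "P \<in> carrier G" "dst G (Tpt G) P = (1 / 2) ^ n" by blast
  have "dst G (Tpt G) (g (tensor_elem G Ca P)) = (1 / 2) ^ Suc n"
    using dst_g[OF tripointed_metricD(1)[OF tripointed_metric_G] P(1), of Ca Ca] P(2) g_points(1)
    by simp
  then show ?case using g_in[OF tensor_elem_in[OF P(1)]] by blast
qed

lemma identity_not_continuous:
  "(\<lambda>P\<in>carrier G. P) \<notin> cont_hom G discrete_G"
proof
  note M = tripointed_metricD[OF tripointed_metric_G]
  interpret G: Metric_space "carrier G" "dst G" by (rule M(4))
  interpret D: Metric_space "carrier G" "dst discrete_G"
    using tripointed_metricD(4)[OF tripointed_metric_discrete_G] by simp
  let ?i = "\<lambda>P\<in>carrier G. P"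
  assume "?i \<in> cont_hom G discrete_G"
  then have c: "continuous_map G.mtopology D.mtopology ?i"
    by (simp add: cont_hom_def met_of_def G.mtopology_of D.mtopology_of)
  \<comment> \<open>A discrete ball of radius 1/2 is a singleton. Continuity would make
    \<open>{T}\<close> open in \<open>G\<close> too, leaving a ball around \<open>T\<close> without
    any of the points from \<open>points_near_top\<close>.\<close>
  have "openin D.mtopology {Tpt G}"
    unfolding D.openin_mtopology using M(1) by (auto simp: D.mball_def intro!: exI[of _ "1 / 2"] split: if_splits)
  then have "openin G.mtopology {P \<in> topspace G.mtopology. ?i P \<in> {Tpt G}}"
    using c by (rule openin_continuous_map_preimage[rotated])
  then obtain r where r: "r > 0" "G.mball (Tpt G) r \<subseteq> {P \<in> carrier G. ?i P = Tpt G}"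
    using M(1) unfolding G.openin_mtopology by auto
  obtain n where n: "(1 / 2 :: real) ^ n < r"
    using real_arch_pow_inv[OF r(1), of "1 / 2"] by auto
  obtain P where P: "P \<in> carrier G" "dst G (Tpt G) P = (1 / 2) ^ n" using points_near_top by blast
  then have "P \<in> G.mball (Tpt G) r" using n M(1) by simp
  then have "P \<in> {P \<in> carrier G. ?i P = Tpt G}" using r(2) by blast
  then have "P = Tpt G" by (simp add: P(1))
  then show False using P M(1,17) by simp
qed

text \<open>What fails is existence: forgetting continuity, a morphism is one of tri-pointed sets
  and must equal the identity.\<close>

lemma no_cont_hom_discrete_G: "alg_hom (cont_hom G discrete_G) G g discrete_G g = {}"
proof -
  have False if f: "f \<in> alg_hom (cont_hom G discrete_G) G g discrete_G g" for f
  proof -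
    have "f \<in> alg_hom (set_hom G discrete_G) G g discrete_G g" "f \<in> cont_hom G discrete_G"
      using f by (auto simp: alg_hom_def cont_hom_def)
    then show False
      using alg_hom_unique identity_hom_discrete_G identity_not_continuous by metis
  qed
  then show ?thesis by blast
qed

theorem mainTheorem7:
  shows "set_initial G g TYPE('b)
       \<and> tripointed_metric G \<and> isometric_iso (tensor_met G) G g
       \<and> \<not> cont_initial G g TYPE(gpoint)
       \<and> \<not> lip_initial G g TYPE(gpoint)"
proof (intro conjI)
  show "\<not> cont_initial G g TYPE(gpoint)"
    using no_cont_hom_discrete_G lip_alg_imp_cont_alg[OF lip_alg_discrete_G]
    unfolding cont_initial_def by blast
  have "alg_hom (lip_hom G discrete_G) G g discrete_G g = {}"
    using no_cont_hom_discrete_G lip_hom_subset_cont_hom[of G discrete_G] unfolding alg_hom_def by blast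
  then show "\<not> lip_initial G g TYPE(gpoint)"
    using lip_alg_discrete_G unfolding lip_initial_def by blast
qed (rule set_initial_G tripointed_metric_G isometric_iso_g)+

end
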